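(* Let $r>0$, let $s\ge2$ be an integer, and let $a>1/2$. Put $d_N:=d_N(U^{r,a}(\mathbb T^s),L_2(\mathbb T^s))$ and $T^*:=16\lceil(a+1/2)^s\rceil$. Then for every $N\in\mathbb N$ satisfying $$N\ \ge\ \frac{2^s}{(s-1)!}\left[\frac{T^*\bigl(\ln T^*-s\ln(a-1/2)\bigr)^s}{\ln T^*+s\bigl(1-\ln(a-1/2)\bigr)-1}\right]$$ we have $$d_N\ \le\ 2^r\left(\left[\frac{N(s-1)!}{2^s}\right]^{-1}\left[\ln\frac{N(s-1)!}{(2a-1)^s}\right]^{s-1}\right)^r,$$ and there is a number $N^*(s,a)\in\mathbb N$ such that for every $N\ge N^*(s,a)$, $$d_N\ \ge\ 2^{-1}\left(\left[\frac{N(s-1)!(s+2)}{2^s}\right]^{-1}\left[\ln\frac{N(s-1)!}{(2a+1)^s}\right]^{s-1}\right)^r.$$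
   Context: $\mathbb N=\{1,2,\dots\}$. $\mathbb T^s=[-\pi,\pi]^s$ is the $s$-dimensional torus, and $L_2(\mathbb T^s)$ carries the inner product $(f,g)=(2\pi)^{-s}\int_{\mathbb T^s}f(\mathbf x)\overline{g(\mathbf x)}\,d\mathbf x$ and norm $\|f\|=(f,f)^{1/2}$. For $\mathbf k\in\mathbb Z^s$, $e_{\mathbf k}(\mathbf x)=e^{i(\mathbf k,\mathbf x)}$, $\hat f(\mathbf k)=(f,e_{\mathbf k})$. For $a>0$ put $\lambda_a(\mathbf k):=\prod_{j=1}^s(a+|k_j|)$. The modified Korobov space $K^{r,a}(\mathbb T^s)$ is the Hilbert space of all $f=\kappa_{r,a}*g$ with $g\in L_2(\mathbb T^s)$, where $\kappa_{r,a}=\sum_{\mathbf k\in\mathbb Z^s}\lambda_a(\mathbf k)^{-r}e_{\mathbf k}$ (in the distributional sense), i.e. $\hat f(\mathbf k)=\lambda_a(\mathbf k)^{-r}\hat g(\mathbf k)$, with norm $\|f\|_{K^{r,a}(\mathbb T^s)}:=\|g\|$; equivalently $\|f\|^2_{K^{r,a}(\mathbb T^s)}=\sum_{\mathbf k}\lambda_a(\mathbf k)^{2r}|\hat f(\mathbf k)|^2$. $U^{r,a}(\mathbb T^s)$ is its (closed) unit ball. For a normed space $X$ and a centrally symmetric $W\subset X$, the Kolmogorov $N$-width is $d_N(W,X):=\inf_{L_N}\sup_{f\in W}\inf_{g\in L_N}\|f-g\|_X$, the outer infimum over all linear subspaces $L_N\subset X$ of dimension $\le N$. *)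

theory Defs
  imports "HOL-Analysis.Analysis" "HOL-Library.Function_Algebras"
begin

text \<open>
  Complex-valued functions form a complex vector space under pointwise operations; addition and
  subtraction of functions come from \<^theory>\<open>HOL-Library.Function_Algebras\<close>.
\<close>

interpretation cfun: vector_space "\<lambda>(c::complex) (f::'a \<Rightarrow> complex) x. c * f x"
  by unfold_locales (auto simp: fun_eq_iff algebra_simps)

text \<open>
  The space \<open>X\<close> is given by a carrier of functions and a (semi)norm \<open>nrm\<close>; elements of a function
  space of Lebesgue type are handled through representatives. This does not affect widths: a
  subspace of dimension at most \<open>N\<close> of the quotient modulo null functions is the image of the span
  of at most \<open>N\<close> representatives, and conversely. Dimension is expressed by a finite spanning set
  because \<open>cfun.dim\<close> is 0 for infinite-dimensional spaces. Values are extended reals, so that the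
  supremum is meaningful for unbounded \<open>W\<close>.
\<close>

definition kolmogorov_width ::
  "nat \<Rightarrow> ('a \<Rightarrow> complex) set \<Rightarrow> ('a \<Rightarrow> complex) set \<Rightarrow> (('a \<Rightarrow> complex) \<Rightarrow> real) \<Rightarrow> ereal" where
  "kolmogorov_width N W X nrm =
     (INF L \<in> {L. L \<subseteq> X \<and> (\<exists>B. finite B \<and> card B \<le> N \<and> L = cfun.span B)}.
        SUP f \<in> W. INF g \<in> L. ereal (nrm (f - g)))"

definition torus :: "(real ^ 'n) set" where
  "torus = cbox (\<chi> j. - pi) (\<chi> j. pi)"

definition L2 :: "(real ^ 'n \<Rightarrow> complex) set" where
  "L2 = {f. f \<in> borel_measurable (lebesgue_on torus) \<and>
            integrable (lebesgue_on torus) (\<lambda>x. (cmod (f x))\<^sup>2)}"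

definition L2_inner :: "(real ^ 'n \<Rightarrow> complex) \<Rightarrow> (real ^ 'n \<Rightarrow> complex) \<Rightarrow> complex" where
  "L2_inner f g =
     (\<integral>x. f x * cnj (g x) \<partial>lebesgue_on torus) / of_real ((2 * pi) ^ CARD('n))"

definition L2_norm :: "(real ^ 'n \<Rightarrow> complex) \<Rightarrow> real" where
  "L2_norm f = sqrt (Re (L2_inner f f))"

definition trig :: "int ^ 'n \<Rightarrow> real ^ 'n \<Rightarrow> complex" where
  "trig k x = exp (\<i> * of_real (\<Sum>j\<in>UNIV. of_int (k $ j) * x $ j))"

definition fourier_coeff :: "(real ^ 'n \<Rightarrow> complex) \<Rightarrow> int ^ 'n \<Rightarrow> complex" where
  "fourier_coeff f k = L2_inner f (trig k)"

definition korobov_weight :: "real \<Rightarrow> int ^ 'n \<Rightarrow> real" where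
  "korobov_weight a k = (\<Prod>j\<in>UNIV. a + \<bar>of_int (k $ j)\<bar>)"

text \<open>
  \<open>is_korobov_conv r a g f\<close> says that \<open>f\<close> is the convolution of \<open>g\<close> with the distribution
  \<open>\<Sum>k. korobov_weight a k powr (- r) * trig k\<close>, in terms of Fourier coefficients.
\<close>

definition is_korobov_conv ::
  "real \<Rightarrow> real \<Rightarrow> (real ^ 'n \<Rightarrow> complex) \<Rightarrow> (real ^ 'n \<Rightarrow> complex) \<Rightarrow> bool" where
  "is_korobov_conv r a g f \<longleftrightarrow>
     (\<forall>k. fourier_coeff f k = of_real (korobov_weight a k powr (- r)) * fourier_coeff g k)"

text \<open>
  For \<open>a > 0\<close> the multipliers are bounded when \<open>r > 0\<close>, so the convolution of a function in \<open>L2\<close>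
  is again in \<open>L2\<close>.
\<close>

definition korobov_space :: "real \<Rightarrow> real \<Rightarrow> (real ^ 'n \<Rightarrow> complex) set" where
  "korobov_space r a = {f \<in> L2. \<exists>g\<in>L2. is_korobov_conv r a g f}"

text \<open>
  The function \<open>g\<close> is determined by \<open>f\<close> up to a null set (for \<open>a > 0\<close>), so its norm is unique.
\<close>

definition korobov_norm :: "real \<Rightarrow> real \<Rightarrow> (real ^ 'n \<Rightarrow> complex) \<Rightarrow> real" where
  "korobov_norm r a f = (THE c. \<exists>g\<in>L2. is_korobov_conv r a g f \<and> c = L2_norm g)"

definition korobov_ball :: "real \<Rightarrow> real \<Rightarrow> (real ^ 'n \<Rightarrow> complex) set" where
  "korobov_ball r a = {f \<in> korobov_space r a. korobov_norm r a f \<le> 1}"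

end

theory Submission
  imports Defs "HOL-Real_Asymp.Real_Asymp"
begin

text \<open>
  Since the trigonometric system is orthonormal and complete, the convolution acts diagonally and
  the width is governed by the hyperbolic crosses \<open>{k. korobov_weight a k \<le> X}\<close>: a cross with at most
  \<open>N\<close> elements gives \<open>d\<^sub>N \<le> X powr (- r)\<close> by partial Fourier sums, and one with more than \<open>N\<close> elements
  gives \<open>d\<^sub>N \<ge> X powr (- r)\<close>, because it contains a trigonometric polynomial orthogonal to the given
  \<open>N\<close>-dimensional subspace. It remains to count. With \<open>b = a - 1 / 2\<close>, induction on the dimension
  bounds the count from above by \<open>2 ^ s / (s - 1)! * X * ln (X / b ^ s) ^ (s - 1)\<close> for every
  \<open>X \<ge> b ^ s\<close>, and from below by half of such an expression, with \<open>b ^ s\<close> replaced by a larger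
  constant; the factor \<open>s + 2\<close> in the lower estimate leaves room for that loss.
\<close>

section \<open>Counting points of hyperbolic crosses\<close>

text \<open>The shift 1/2 in \<open>b\<close> comes from symmetry: among the frequencies -K..K of
  one coordinate, 0 occurs once and every other absolute value twice. Hence half a unit interval is
  enough for the term at \<open>a\<close>, and the comparison integral starts at
  \<open>a - 1 / 2\<close>. The lower count drops the frequency 0 and starts its integral at
  \<open>a + 1\<close>. Turning counts into widths means inverting X * ln (X / const) ^ (s - 1).
  Above, this is done by an explicit choice of X in which the logarithm at X is replaced by a larger
  one; the 2 in that choice is the source of \<open>2 powr r\<close>, and the threshold with
  \<open>T\<close> serves to make the logarithm at least 1. Below, the inversion is asymptotic,
  whence the unspecified \<open>Nstar\<close>; as only counting is involved, \<open>Nstar\<close>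
  does not depend on \<open>r\<close>. The analytic obstacle is completeness. The torus is encoded
  as a closed cube whose opposite faces are not identified, so trigonometric polynomials do not
  separate its points. Completeness enters in two places: the uniqueness behind the definite
  description in \<open>korobov_norm\<close>, and the tail estimate for partial Fourier
  sums.\<close>

definition cross :: "real \<Rightarrow> 'i set \<Rightarrow> real \<Rightarrow> ('i \<Rightarrow> int) set" where
  "cross a I T = {k. (\<forall>j. j \<notin> I \<longrightarrow> k j = 0) \<and> (\<Prod>j\<in>I. a + \<bar>of_int (k j)\<bar>) \<le> T}"

lemma cross_empty: "cross a {} T = (if 1 \<le> T then {\<lambda>_. 0} else {})"
  by (auto simp: cross_def)

text \<open>Crosses are indexed by a varying set \<open>I\<close> and extended by 0 outside it, so
  that all dimensions live in one type and an induction can add coordinates one at a time.\<close>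

lemma cross_insert:
  assumes "finite I" "j \<notin> I" "a > 0"
  shows "cross a (insert j I) T = (\<Union>m. (\<lambda>k. k(j := m)) ` cross a I (T / (a + \<bar>of_int m\<bar>)))"
proof -
  have pos: "a + \<bar>of_int m\<bar> > 0" for m :: int
    using assms(3) by linarith
  have "k \<in> cross a (insert j I) T \<longleftrightarrow> k(j := 0) \<in> cross a I (T / (a + \<bar>of_int (k j)\<bar>))" for k
  proof -
    have "(\<Prod>i\<in>I. a + \<bar>of_int ((k(j := 0)) i)\<bar>) = (\<Prod>i\<in>I. a + \<bar>real_of_int (k i)\<bar>)"
      using assms(2) by (intro prod.cong) auto
    then show ?thesis
      using assms pos[of "k j"] by (auto simp: cross_def field_simps)
  qed
  moreover have "k(j := m) \<in> cross a (insert j I) T"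
    if "k \<in> cross a I (T / (a + \<bar>of_int m\<bar>))" for k m
  proof -
    have "(\<Prod>i\<in>I. a + \<bar>of_int ((k(j := m)) i)\<bar>) = (\<Prod>i\<in>I. a + \<bar>real_of_int (k i)\<bar>)"
      using assms(2) by (intro prod.cong) auto
    then show ?thesis
      using assms pos[of m] that by (auto simp: cross_def field_simps)
  qed
  ultimately show ?thesis
    by (force simp: image_iff intro!: exI[where x = "_ j"] bexI[where x = "_(j := 0)"])
qed

lemma inj_on_fun_upd_cross: "j \<notin> I \<Longrightarrow> inj_on (\<lambda>k. k(j := m)) (cross a I T)"
proof (rule inj_onI)
  fix k l assume "j \<notin> I" "k \<in> cross a I T" "l \<in> cross a I T" and eq: "k(j := m) = l(j := m)"
  then have "k j = l j"
    by (simp add: cross_def)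
  moreover have "k i = l i" if "i \<noteq> j" for i
    using fun_cong[OF eq, of i] that by simp
  ultimately show "k = l"
    by (metis ext)
qed

lemma card_UN_cross:
  assumes "finite A" "j \<notin> I" "\<And>m. m \<in> A \<Longrightarrow> finite (cross a I (g m))"
  shows "card (\<Union>m\<in>A. (\<lambda>k. k(j := m)) ` cross a I (g m)) = (\<Sum>m\<in>A. card (cross a I (g m)))"
  using assms
  by (subst card_UN_disjoint) (auto simp: card_image inj_on_fun_upd_cross dest: fun_upd_eqD)

text \<open>Every factor is at least \<open>a\<close> and so exceeds \<open>b\<close>. For
  \<open>b = a - 1 / 2\<close> the level \<open>b ^ card I\<close> is exactly where
  \<open>card_cross_le\<close> begins to apply, so each fibre is either empty or covered by the
  induction hypothesis.\<close>

lemma cross_eq_empty: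
  assumes "finite I" "I \<noteq> {}" "b > 0" "b < a" "T \<le> b ^ card I"
  shows "cross a I T = {}"
proof -
  have "b ^ card I < (\<Prod>j\<in>I. a + \<bar>of_int (k j)\<bar>)" for k :: "'a \<Rightarrow> int"
  proof -
    have lt: "b < a + \<bar>of_int (k j)\<bar>" for j
      using assms by linarith
    from assms(2) obtain i where "i \<in> I" by auto
    then show ?thesis
      unfolding prod_constant[symmetric] using assms lt
      by (intro prod_mono_strict[of i]) (auto intro: less_imp_le order.strict_trans)
  qed
  then show ?thesis
    using assms(5) by (auto simp: cross_def not_le dest: order.strict_trans1)
qed

lemma abs_le_eq_atLeastAtMost:
  "{m::int. \<bar>real_of_int m\<bar> \<le> x} = {- \<lfloor>x\<rfloor>..\<lfloor>x\<rfloor>}"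
proof (rule set_eqI)
  fix m :: int
  have "\<bar>real_of_int m\<bar> \<le> x \<longleftrightarrow> real_of_int m \<le> x \<and> real_of_int (- m) \<le> x"
    by auto
  also have "\<dots> \<longleftrightarrow> m \<le> \<lfloor>x\<rfloor> \<and> - m \<le> \<lfloor>x\<rfloor>"
    by (simp only: le_floor_iff)
  finally show "m \<in> {m. \<bar>real_of_int m\<bar> \<le> x} \<longleftrightarrow> m \<in> {- \<lfloor>x\<rfloor>..\<lfloor>x\<rfloor>}"
    by auto
qed

lemma finite_cross:
  assumes "finite I" "a > 0"
  shows "finite (cross a I T)"
  using assms(1)
proof (induction I arbitrary: T rule: finite_induct)
  case empty
  show ?case by (simp add: cross_empty)
next
  case (insert j I)
  \<comment> \<open>The other factors contribute at least \<open>a ^ card I\<close>, so a non-empty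
    fibre forces |m| to be at most this \<open>Z\<close>.\<close>
  define Z where "Z = T / a ^ card I"
  have "(\<Union>m. (\<lambda>k. k(j := m)) ` cross a I (T / (a + \<bar>of_int m\<bar>)))
      \<subseteq> (\<Union>m\<in>{m. \<bar>real_of_int m\<bar> \<le> Z}. (\<lambda>k. k(j := m)) ` cross a I (T / (a + \<bar>of_int m\<bar>)))"
  proof safe
    fix m k assume k: "k \<in> cross a I (T / (a + \<bar>of_int m\<bar>))"
    have "a ^ card I \<le> (\<Prod>j\<in>I. a + \<bar>of_int (k j)\<bar>)"
      unfolding prod_constant[symmetric] using assms by (intro prod_mono) auto
    also have "\<dots> \<le> T / (a + \<bar>of_int m\<bar>)"
      using k by (simp add: cross_def)
    finally have "\<bar>of_int m\<bar> \<le> Z"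
      using assms by (simp add: Z_def field_simps add_pos_nonneg)
        (smt (verit) mult_pos_pos zero_less_power)
    then show "k(j := m) \<in> (\<Union>m\<in>{m. \<bar>real_of_int m\<bar> \<le> Z}. (\<lambda>k. k(j := m)) ` cross a I (T / (a + \<bar>of_int m\<bar>)))"
      using k by blast
  qed
  moreover have "finite (\<Union>m\<in>{m. \<bar>real_of_int m\<bar> \<le> Z}. (\<lambda>k. k(j := m)) ` cross a I (T / (a + \<bar>of_int m\<bar>)))"
    using insert by (simp add: abs_le_eq_atLeastAtMost)
  ultimately show ?case
    by (simp only: cross_insert[OF insert.hyps assms(2)] finite_subset)
qed

section \<open>Logarithmic sums compared with integrals\<close>

lemma sum_symmetric_int:
  fixes h :: "int \<Rightarrow> real"
  assumes "\<And>m. h (- m) = h m"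
  shows "(\<Sum>m=- int K..int K. h m) = h 0 + 2 * (\<Sum>m=1..K. h (int m))"
proof (induction K)
  case (Suc K)
  have "{- int (Suc K)..int (Suc K)} = insert (- int (Suc K)) (insert (int (Suc K)) {- int K..int K})"
    by auto
  then show ?case
    using Suc assms[of "int (Suc K)"] by simp
qed simp

text \<open>A mean value estimate in algebraic form: the factorisation of
  \<open>x ^ n - y ^ n\<close> has \<open>n\<close> summands, each between
  \<open>y ^ (n - 1)\<close> and \<open>x ^ (n - 1)\<close>.\<close>

lemma power_diff_bounds:
  fixes x y :: real
  assumes "0 \<le> y" "y \<le> x" "n > 0"
  shows "real n * y ^ (n - 1) * (x - y) \<le> x ^ n - y ^ n"
    and "x ^ n - y ^ n \<le> real n * x ^ (n - 1) * (x - y)"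
proof -
  obtain q where n: "n = Suc q" using assms(3) by (cases n) auto
  have le: "y ^ q \<le> x ^ p * y ^ (q - p)" "x ^ p * y ^ (q - p) \<le> x ^ q" if "p \<le> q" for p
  proof -
    have "y ^ p * y ^ (q - p) \<le> x ^ p * y ^ (q - p)"
      using assms by (intro mult_right_mono power_mono) auto
    then show "y ^ q \<le> x ^ p * y ^ (q - p)"
      using that by (simp flip: power_add)
    have "x ^ p * y ^ (q - p) \<le> x ^ p * x ^ (q - p)"
      using assms by (intro mult_left_mono power_mono) auto
    then show "x ^ p * y ^ (q - p) \<le> x ^ q"
      using that by (simp flip: power_add)
  qed
  have eq: "x ^ n - y ^ n = (x - y) * (\<Sum>p<Suc q. x ^ p * y ^ (q - p))"
    unfolding n diff_power_eq_sum ..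
  have "(\<Sum>p<Suc q. y ^ q) \<le> (\<Sum>p<Suc q. x ^ p * y ^ (q - p))"
    "(\<Sum>p<Suc q. x ^ p * y ^ (q - p)) \<le> (\<Sum>p<Suc q. x ^ q)"
    using le by (intro sum_mono; simp)+
  then have "(x - y) * (real n * y ^ q) \<le> x ^ n - y ^ n" "x ^ n - y ^ n \<le> (x - y) * (real n * x ^ q)"
    unfolding eq using assms by (intro mult_left_mono; simp add: n)+
  then show "real n * y ^ (n - 1) * (x - y) \<le> x ^ n - y ^ n"
    "x ^ n - y ^ n \<le> real n * x ^ (n - 1) * (x - y)"
    by (simp_all add: n algebra_simps)
qed

text \<open>The right-hand side is the integral of \<open>ln (Z / t) ^ n / t\<close> over
  [y - \<delta>, y]. The integrand decreases up to \<open>Z\<close>, so the rectangle at the right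
  endpoint lies below it. The width \<delta> stays free because steps of length 1 and one step of
  length 1/2 are needed.\<close>

lemma ln_power_step_le:
  assumes "0 \<le> \<delta>" "\<delta> < y" "y \<le> Z"
  shows "\<delta> * (ln (Z / y) ^ n / y) \<le> (ln (Z / (y - \<delta>)) ^ Suc n - ln (Z / y) ^ Suc n) / Suc n"
proof -
  have pos: "0 < y" "0 < Z" using assms by auto
  have "ln (Z / (y - \<delta>)) - ln (Z / y) = - ln (1 + (- \<delta> / y))"
    using pos assms by (simp add: ln_div field_simps)
  moreover have "ln (1 + (- \<delta> / y)) \<le> - \<delta> / y"
    using pos assms by (intro ln_add_one_self_le_self2) (simp add: field_simps)
  ultimately have *: "\<delta> / y \<le> ln (Z / (y - \<delta>)) - ln (Z / y)" by simp
  have nonneg: "0 \<le> ln (Z / y)" using pos assms by simp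
  have "0 \<le> \<delta> / y" using pos assms by simp
  then have "real (Suc n) * ln (Z / y) ^ n * (ln (Z / (y - \<delta>)) - ln (Z / y))
      \<le> ln (Z / (y - \<delta>)) ^ Suc n - ln (Z / y) ^ Suc n"
    using power_diff_bounds(1)[of "ln (Z / y)" "ln (Z / (y - \<delta>))" "Suc n"] nonneg * by simp
  moreover have "real (Suc n) * ln (Z / y) ^ n * (\<delta> / y)
      \<le> real (Suc n) * ln (Z / y) ^ n * (ln (Z / (y - \<delta>)) - ln (Z / y))"
    using * nonneg by (intro mult_left_mono) auto
  ultimately have "real (Suc n) * (\<delta> * (ln (Z / y) ^ n / y))
      \<le> ln (Z / (y - \<delta>)) ^ Suc n - ln (Z / y) ^ Suc n"
    by (simp add: mult_ac)
  then show ?thesis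
    by (simp add: pos_le_divide_eq mult.commute)
qed

text \<open>Here the rectangle at the left endpoint of [y, y + 1] lies above the integral. Beyond
  \<open>Z\<close> the logarithm is negative and its powers are no longer monotone, so
  \<open>max 0\<close> cuts the interval off at \<open>Z\<close>.\<close>

lemma ln_power_step_ge:
  assumes "0 < y" "y \<le> Z"
  shows "(ln (Z / y) ^ Suc n - max 0 (ln (Z / (y + 1))) ^ Suc n) / Suc n \<le> ln (Z / y) ^ n / y"
proof -
  let ?B = "max 0 (ln (Z / (y + 1)))"
  have pos: "0 < Z" using assms by auto
  have nonneg: "0 \<le> ln (Z / y)" using pos assms by simp
  have "ln (Z / y) - ln (Z / (y + 1)) = ln (1 + 1 / y)"
    using pos assms by (simp add: ln_div field_simps)
  also have "\<dots> \<le> 1 / y"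
    using assms by (intro ln_add_one_self_le_self) simp
  finally have *: "ln (Z / y) - ?B \<le> 1 / y" by simp
  have "ln (Z / (y + 1)) \<le> ln (Z / y)"
    using assms pos by (intro ln_mono) (auto simp: field_simps)
  then have "ln (Z / y) ^ Suc n - ?B ^ Suc n \<le> real (Suc n) * ln (Z / y) ^ n * (ln (Z / y) - ?B)"
    using power_diff_bounds(2)[of ?B "ln (Z / y)" "Suc n"] nonneg by simp
  also have "\<dots> \<le> real (Suc n) * ln (Z / y) ^ n * (1 / y)"
    using * nonneg by (intro mult_left_mono) auto
  finally show ?thesis
    by (simp add: pos_divide_le_eq mult_ac)
qed

text \<open>After division by 2, the terms with m >= 1 are covered by the unit intervals that fill
  [a, a + K], while the term at \<open>a\<close> has weight 1/2 and is covered by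
  [a - 1/2, a].\<close>

lemma sum_ln_power_le:
  assumes "a > 1 / 2" "a + real K \<le> Z"
  shows "ln (Z / a) ^ n / a + 2 * (\<Sum>m=1..K. ln (Z / (a + real m)) ^ n / (a + real m))
      \<le> 2 * ln (Z / (a - 1 / 2)) ^ Suc n / Suc n"
proof -
  have "(\<Sum>m=1..k. ln (Z / (a + real m)) ^ n / (a + real m))
      \<le> (ln (Z / a) ^ Suc n - ln (Z / (a + real k)) ^ Suc n) / Suc n" if "k \<le> K" for k
    using that
  proof (induction k)
    case (Suc k)
    then show ?case
      using ln_power_step_le[of 1 "a + real (Suc k)" Z n] assms by (simp add: diff_divide_distrib)
  qed simp
  from this[of K] have "(\<Sum>m=1..K. ln (Z / (a + real m)) ^ n / (a + real m))
      \<le> (ln (Z / a) ^ Suc n - ln (Z / (a + real K)) ^ Suc n) / Suc n"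
    by simp
  also have "\<dots> \<le> ln (Z / a) ^ Suc n / Suc n"
    using assms by (intro divide_right_mono) auto
  finally have "(\<Sum>m=1..K. ln (Z / (a + real m)) ^ n / (a + real m)) \<le> ln (Z / a) ^ Suc n / Suc n" .
  moreover have "1 / 2 * (ln (Z / a) ^ n / a) \<le> (ln (Z / (a - 1 / 2)) ^ Suc n - ln (Z / a) ^ Suc n) / Suc n"
    using ln_power_step_le[of "1 / 2" a Z n] assms by simp
  ultimately show ?thesis
    by (simp add: diff_divide_distrib)
qed

text \<open>The unit intervals to the right of \<open>a + m\<close> start at \<open>a + 1\<close>,
  and the last one reaches \<open>Z\<close>, where the truncated primitive vanishes.\<close>

lemma sum_ln_power_ge:
  assumes "a > 0" "a + 1 \<le> Z"
  shows "ln (Z / (a + 1)) ^ Suc n / Suc n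
      \<le> (\<Sum>m=1..nat \<lfloor>Z - a\<rfloor>. ln (Z / (a + real m)) ^ n / (a + real m))"
proof -
  define K where "K = nat \<lfloor>Z - a\<rfloor>"
  have K: "a + real K \<le> Z" "Z \<le> a + real K + 1"
    using assms unfolding K_def by linarith+
  have "(max 0 (ln (Z / (a + 1))) ^ Suc n - max 0 (ln (Z / (a + real k + 1))) ^ Suc n) / Suc n
      \<le> (\<Sum>m=1..k. ln (Z / (a + real m)) ^ n / (a + real m))" if "k \<le> K" for k
    using that
  proof (induction k)
    case (Suc k)
    have le: "a + real (Suc k) \<le> Z"
      using K Suc.prems by linarith
    \<comment> \<open>The truncation acts only at the final endpoint; at every earlier one the
      argument of the logarithm is still at least 1.\<close>
    moreover have "max 0 (ln (Z / (a + real k + 1))) = ln (Z / (a + real (Suc k)))"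
      using le assms by (simp add: add_ac)
    ultimately show ?case
      using Suc ln_power_step_ge[of "a + real (Suc k)" Z n] assms
      by (simp add: diff_divide_distrib add_ac)
  qed simp
  note this[of K]
  moreover have "max 0 (ln (Z / (a + 1))) = ln (Z / (a + 1))"
    using assms by simp
  moreover have "ln (Z / (a + real K + 1)) \<le> 0"
    using K assms by (intro ln_le_zero_iff[THEN iffD2]) (auto simp: field_simps)
  then have "max 0 (ln (Z / (a + real K + 1))) = 0"
    by simp
  ultimately show ?thesis
    by (simp add: K_def)
qed

lemma card_cross_insert:
  assumes "finite I" "j \<notin> I" "a > 0" "finite A"
    and "\<And>m. m \<notin> A \<Longrightarrow> cross a I (T / (a + \<bar>of_int m\<bar>)) = {}"
  shows "card (cross a (insert j I) T) = (\<Sum>m\<in>A. card (cross a I (T / (a + \<bar>of_int m\<bar>))))"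
proof -
  have "cross a (insert j I) T = (\<Union>m\<in>A. (\<lambda>k. k(j := m)) ` cross a I (T / (a + \<bar>of_int m\<bar>)))"
    unfolding cross_insert[OF assms(1-3)] using assms(5) by blast
  then show ?thesis
    using assms by (simp add: card_UN_cross finite_cross)
qed

lemma card_cross_insert_ge:
  assumes "finite I" "j \<notin> I" "a > 0" "finite A"
  shows "(\<Sum>m\<in>A. card (cross a I (T / (a + \<bar>of_int m\<bar>)))) \<le> card (cross a (insert j I) T)"
proof -
  have "(\<Union>m\<in>A. (\<lambda>k. k(j := m)) ` cross a I (T / (a + \<bar>of_int m\<bar>))) \<subseteq> cross a (insert j I) T"
    unfolding cross_insert[OF assms(1-3)] by blast
  then have "card (\<Union>m\<in>A. (\<lambda>k. k(j := m)) ` cross a I (T / (a + \<bar>of_int m\<bar>))) \<le> card (cross a (insert j I) T)"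
    using assms by (intro card_mono finite_cross) auto
  then show ?thesis
    using assms by (simp add: card_UN_cross finite_cross)
qed

text \<open>Both inductions start from one coordinate and not from the empty set: their step uses
  \<open>fact c = c * fact (c - 1)\<close>, which fails for \<open>c = 0\<close>.\<close>

lemma card_cross_singleton:
  assumes "a > 0"
  shows "real (card (cross a {j} T)) = (if a \<le> T then 2 * of_int \<lfloor>T - a\<rfloor> + 1 else 0)"
proof -
  have ne: "1 \<le> T / (a + \<bar>of_int m\<bar>) \<longleftrightarrow> \<bar>of_int m\<bar> \<le> T - a" for m :: int
    using assms by (auto simp: pos_le_divide_eq add_pos_nonneg)
  have fin: "finite {m. \<bar>real_of_int m\<bar> \<le> T - a}"
    by (simp add: abs_le_eq_atLeastAtMost)
  have "card (cross a {j} T)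
      = (\<Sum>m\<in>{m. \<bar>of_int m\<bar> \<le> T - a}. card (cross a {} (T / (a + \<bar>of_int m\<bar>)) :: ('a \<Rightarrow> int) set))"
    using assms fin by (intro card_cross_insert) (auto simp: cross_empty ne)
  also have "\<dots> = (\<Sum>m\<in>{m. \<bar>of_int m\<bar> \<le> T - a}. 1)"
    by (intro sum.cong) (auto simp: cross_empty ne)
  also have "\<dots> = nat (2 * \<lfloor>T - a\<rfloor> + 1)"
    by (simp add: abs_le_eq_atLeastAtMost)
  finally have card: "card (cross a {j} T) = nat (2 * \<lfloor>T - a\<rfloor> + 1)" .
  show ?thesis
  proof (cases "a \<le> T")
    case False
    then have "2 * \<lfloor>T - a\<rfloor> + 1 \<le> 0" by linarith
    with False show ?thesis unfolding card by simp
  qed (simp add: card)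
qed

text \<open>
  The two bounds below go by induction on \<open>I\<close>: splitting off one coordinate \<open>m\<close> turns the count into
  a sum over \<open>m\<close> of counts for \<open>T / (a + \<bar>m\<bar>)\<close>, and that sum is compared with the integral of
  \<open>ln (Z / y) ^ n / y\<close>, whose primitive is \<open>- ln (Z / y) ^ Suc n / Suc n\<close>.
\<close>

lemma card_cross_le:
  assumes "finite I" "I \<noteq> {}" "a > 1 / 2" "(a - 1 / 2) ^ card I \<le> T"
  shows "real (card (cross a I T))
    \<le> 2 ^ card I / fact (card I - 1) * T * ln (T / (a - 1 / 2) ^ card I) ^ (card I - 1)"
  using assms(1,2,4)
proof (induction I arbitrary: T rule: finite_ne_induct)
  \<comment> \<open>The count is at most 2 (T - a) + 1, and this is at most 2 T because 2 a >
    1.\<close>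
  case (singleton j)
  then show ?case
    using assms(3) by (simp add: card_cross_singleton) linarith
next
  case (insert j I)
  define b where "b = a - 1 / 2"
  define c where "c = card I"
  define Z where "Z = T / b ^ c"
  define C where "C = 2 ^ c / fact (c - 1) * T"
  define A where "A = {m. \<bar>real_of_int m\<bar> \<le> Z - a}"
  have b: "0 < b" "b < a" using assms(3) by (auto simp: b_def)
  have c: "c > 0" using insert by (simp add: c_def card_gt_0_iff)
  have T: "b ^ Suc c \<le> T" using insert by (simp add: b_def c_def)
  then have "0 < T"
    using b by (intro less_le_trans[OF _ T]) auto
  then have C: "C \<ge> 0" by (simp add: C_def)
  have Zb: "1 \<le> Z / b"
    using T b by (simp add: Z_def field_simps)
  have rhs: "C * (2 * ln (Z / b) ^ c / c)
      = 2 ^ card (insert j I) / fact (card (insert j I) - 1) * T * ln (T / b ^ card (insert j I)) ^ (card (insert j I) - 1)"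
  proof -
    have "fact c = real c * fact (c - 1)"
      using c by (simp add: fact_reduce)
    moreover have "T / b ^ Suc c = Z / b"
      by (simp add: Z_def)
    moreover have "card (insert j I) = Suc c"
      using insert by (simp add: c_def)
    ultimately show ?thesis
      by (simp add: C_def mult_ac)
  qed
  \<comment> \<open>The range \<open>A\<close> of \<open>m\<close> is chosen to consist of exactly
    those fibres whose level reaches the threshold of the induction hypothesis; all others are
    empty.\<close>
  have le_iff: "b ^ c \<le> T / (a + \<bar>of_int m\<bar>) \<longleftrightarrow> \<bar>of_int m\<bar> \<le> Z - a" for m :: int
    using b by (auto simp: Z_def field_simps add_pos_nonneg)
  have "real (card (cross a (insert j I) T)) = (\<Sum>m\<in>A. real (card (cross a I (T / (a + \<bar>of_int m\<bar>)))))"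
    unfolding of_nat_sum[symmetric] of_nat_eq_iff
  proof (rule card_cross_insert)
    show "cross a I (T / (a + \<bar>of_int m\<bar>)) = {}" if "m \<notin> A" for m
      using that insert b le_iff[of m] 
      by (intro cross_eq_empty[of I b]) (auto simp: A_def c_def)
  qed (use insert b in \<open>auto simp: A_def abs_le_eq_atLeastAtMost\<close>)
  also have "\<dots> \<le> (\<Sum>m\<in>A. C * (ln (Z / (a + \<bar>of_int m\<bar>)) ^ (c - 1) / (a + \<bar>of_int m\<bar>)))"
  proof (rule sum_mono)
    fix m assume "m \<in> A"
    then have "b ^ c \<le> T / (a + \<bar>of_int m\<bar>)"
      using le_iff by (simp add: A_def)
    from insert.IH[folded c_def b_def, OF this]
    show "real (card (cross a I (T / (a + \<bar>of_int m\<bar>))))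
      \<le> C * (ln (Z / (a + \<bar>of_int m\<bar>)) ^ (c - 1) / (a + \<bar>of_int m\<bar>))"
      by (simp add: C_def Z_def mult_ac)
  qed
  also have "\<dots> = C * (\<Sum>m\<in>A. ln (Z / (a + \<bar>of_int m\<bar>)) ^ (c - 1) / (a + \<bar>of_int m\<bar>))"
    by (simp add: sum_distrib_left)
  also have "\<dots> \<le> C * (2 * ln (Z / b) ^ c / c)"
  proof (rule mult_left_mono[OF _ C])
    show "(\<Sum>m\<in>A. ln (Z / (a + \<bar>of_int m\<bar>)) ^ (c - 1) / (a + \<bar>of_int m\<bar>)) \<le> 2 * ln (Z / b) ^ c / c"
    proof (cases "a \<le> Z")
      case True
      define K where "K = nat \<lfloor>Z - a\<rfloor>"
      have A: "A = {- int K..int K}"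
        using True by (simp add: A_def abs_le_eq_atLeastAtMost K_def)
      have K: "a + real K \<le> Z"
        using True unfolding K_def by linarith
      show ?thesis
        unfolding A using sum_ln_power_le[OF assms(3) K, of "c - 1"] c
        by (subst sum_symmetric_int) (simp_all add: b_def)
    next
      case False
      then have "A = {}" by (auto simp: A_def)
      then show ?thesis using Zb by simp
    qed
  qed
  finally show ?case
    unfolding rhs by (simp add: b_def)
qed

lemma card_cross_ge:
  assumes "finite I" "I \<noteq> {}" "a > 0" "(2 * a + 1) * (a + 1) ^ (card I - 1) \<le> T"
  shows "2 ^ card I / (2 * fact (card I - 1)) * T * ln (T / ((2 * a + 1) * (a + 1) ^ (card I - 1))) ^ (card I - 1)
    \<le> real (card (cross a I T))"
  using assms(1,2,4)
proof (induction I arbitrary: T rule: finite_ne_induct)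
  \<comment> \<open>The count exceeds 2 T - 2 a - 1, which is at least T once T >= 2 a + 1. This is
    the origin of the factor \<open>2 * a + 1\<close> and of the lost factor 2; each further
    coordinate contributes \<open>a + 1\<close>, the starting point of the integral in
    \<open>sum_ln_power_ge\<close>.\<close>
  case (singleton j)
  then show ?case
    using assms(3) by (simp add: card_cross_singleton) linarith
next
  case (insert j I)
  define c where "c = card I"
  define D where "D = (2 * a + 1) * (a + 1) ^ (c - 1)"
  define Z where "Z = T / D"
  define C where "C = 2 ^ c / (2 * fact (c - 1)) * T"
  define K where "K = nat \<lfloor>Z - a\<rfloor>"
  have c: "c > 0" using insert by (simp add: c_def card_gt_0_iff)
  have card: "card (insert j I) = Suc c" using insert by (simp add: c_def)
  have D: "D > 0" using assms(3) by (simp add: D_def)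
  have D_Suc: "(2 * a + 1) * (a + 1) ^ c = D * (a + 1)"
    using c by (cases c) (simp_all add: D_def)
  then have T: "D * (a + 1) \<le> T" using insert card by simp
  moreover have "D * (a + 1) > 0" using D assms(3) by simp
  ultimately have "0 < T" by linarith
  then have C: "C \<ge> 0" by (simp add: C_def)
  have Z: "a + 1 \<le> Z" using T D by (simp add: Z_def field_simps)
  then have K: "a + real K \<le> Z" unfolding K_def by linarith
  have lhs: "C * (2 * (ln (Z / (a + 1)) ^ c / c)) =
     2 ^ card (insert j I) / (2 * fact (card (insert j I) - 1)) * T
      * ln (T / ((2 * a + 1) * (a + 1) ^ (card (insert j I) - 1))) ^ (card (insert j I) - 1)"
  proof -
    have "fact c = real c * fact (c - 1)"
      using c by (simp add: fact_reduce)
    moreover have "T / (D * (a + 1)) = Z / (a + 1)"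
      by (simp add: Z_def)
    ultimately show ?thesis
      unfolding card diff_Suc_1 D_Suc by (simp add: C_def mult_ac)
  qed
  have "C * (2 * (ln (Z / (a + 1)) ^ c / c))
      \<le> C * (\<Sum>m=- int K..int K. ln (Z / (a + \<bar>of_int m\<bar>)) ^ (c - 1) / (a + \<bar>of_int m\<bar>))"
  proof (rule mult_left_mono[OF _ C])
    have "0 \<le> ln (Z / a)" using Z assms(3) by simp
    then show "2 * (ln (Z / (a + 1)) ^ c / c)
        \<le> (\<Sum>m=- int K..int K. ln (Z / (a + \<bar>of_int m\<bar>)) ^ (c - 1) / (a + \<bar>of_int m\<bar>))"
      using sum_ln_power_ge[OF assms(3) Z, of "c - 1"] c assms(3)
      by (subst sum_symmetric_int) (simp_all add: K_def add_increasing)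
  qed
  also have "\<dots> = (\<Sum>m=- int K..int K. C * (ln (Z / (a + \<bar>of_int m\<bar>)) ^ (c - 1) / (a + \<bar>of_int m\<bar>)))"
    by (simp add: sum_distrib_left)
  also have "\<dots> \<le> (\<Sum>m=- int K..int K. real (card (cross a I (T / (a + \<bar>of_int m\<bar>)))))"
  proof (rule sum_mono)
    fix m assume "m \<in> {- int K..int K}"
    then have "\<bar>real_of_int m\<bar> \<le> real K" by auto
    then have "a + \<bar>of_int m\<bar> \<le> Z" using K by linarith
    then have "D \<le> T / (a + \<bar>of_int m\<bar>)"
      using D assms(3) by (simp add: Z_def field_simps add_pos_nonneg)
    from insert.IH[folded c_def, folded D_def, OF this]
    show "C * (ln (Z / (a + \<bar>of_int m\<bar>)) ^ (c - 1) / (a + \<bar>of_int m\<bar>))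
        \<le> real (card (cross a I (T / (a + \<bar>of_int m\<bar>))))"
      by (simp add: C_def Z_def mult_ac)
  qed
  also have "\<dots> \<le> real (card (cross a (insert j I) T))"
    unfolding of_nat_sum[symmetric] of_nat_le_iff
    using insert assms(3) by (intro card_cross_insert_ge) auto
  finally show ?case
    unfolding lhs .
qed

section \<open>The space L2 of the torus\<close>

lemma sets_lebesgue_torus [simp]: "torus \<in> sets lebesgue"
  by (simp add: torus_def)

lemma compact_torus: "compact torus"
  by (simp add: torus_def compact_cbox)

lemma finite_measure_torus: "finite_measure (lebesgue_on torus)"
  by (simp add: torus_def finite_measure_lebesgue_on)

lemma torus_iff: "x \<in> torus \<longleftrightarrow> (\<forall>j. \<bar>x $ j\<bar> \<le> pi)"
  by (auto simp: torus_def mem_box_cart abs_le_iff minus_le_iff)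

lemma bounded_measurable_in_L2:
  assumes "f \<in> borel_measurable (lebesgue_on torus)" "\<And>x. x \<in> torus \<Longrightarrow> cmod (f x) \<le> B"
  shows "f \<in> L2"
proof -
  interpret finite_measure "lebesgue_on torus :: (real ^ 'a) measure" by (rule finite_measure_torus)
  have "(cmod (f x))\<^sup>2 \<le> B\<^sup>2" if "x \<in> torus" for x
    using assms(2)[OF that] by (intro power_mono) auto
  then have "integrable (lebesgue_on torus) (\<lambda>x. (cmod (f x))\<^sup>2)"
    using assms(1) by (intro integrable_const_bound[of _ "B\<^sup>2"]) (auto intro!: AE_I2)
  then show ?thesis
    using assms by (simp add: L2_def)
qed

lemma continuous_in_L2:
  fixes f :: "real ^ 'n \<Rightarrow> complex"
  assumes "continuous_on torus f"
  shows "f \<in> L2"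
proof -
  obtain B where "\<And>x. x \<in> torus \<Longrightarrow> cmod (f x) \<le> B"
    using compact_imp_bounded[OF compact_continuous_image[OF assms compact_torus]]
    by (auto simp: bounded_iff)
  moreover have "f \<in> borel_measurable (lebesgue_on torus)"
    using assms by (intro continuous_imp_measurable_on_sets_lebesgue) auto
  ultimately show ?thesis
    by (intro bounded_measurable_in_L2)
qed

lemma norm_add_squared_le:
  "(norm (x + y))\<^sup>2 \<le> 2 * (norm x)\<^sup>2 + 2 * (norm y)\<^sup>2" for x y :: "'a::real_normed_vector"
proof -
  have "(norm (x + y))\<^sup>2 \<le> (norm x + norm y)\<^sup>2"
    by (intro power_mono norm_triangle_ineq) auto
  also have "\<dots> \<le> 2 * (norm x)\<^sup>2 + 2 * (norm y)\<^sup>2"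
    using sum_squares_bound[of "norm x" "norm y"] by (simp add: power2_sum)
  finally show ?thesis .
qed

lemma subspace_L2: "cfun.subspace (L2 :: (real ^ 'n \<Rightarrow> complex) set)"
proof (rule cfun.subspaceI)
  show "0 \<in> (L2 :: (real ^ 'n \<Rightarrow> complex) set)"
    by (rule continuous_in_L2) (simp add: zero_fun_def)
next
  fix f g :: "real ^ 'n \<Rightarrow> complex"
  assume f: "f \<in> L2" and g: "g \<in> L2"
  have le: "AE x in lebesgue_on torus.
      norm ((cmod (f x + g x))\<^sup>2) \<le> norm (2 * (cmod (f x))\<^sup>2 + 2 * (cmod (g x))\<^sup>2)"
    by (simp add: norm_add_squared_le)
  have "(\<lambda>x. f x + g x) \<in> borel_measurable (lebesgue_on torus)"
    using f g by (auto simp: L2_def)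
  moreover from this have "integrable (lebesgue_on torus) (\<lambda>x. (cmod (f x + g x))\<^sup>2)"
    using f g by (intro Bochner_Integration.integrable_bound[OF _ _ le]) (simp_all add: L2_def)
  ultimately show "f + g \<in> L2"
    by (simp add: L2_def plus_fun_def)
next
  fix c and f :: "real ^ 'n \<Rightarrow> complex"
  assume "f \<in> L2"
  then show "(\<lambda>x. c * f x) \<in> L2"
    by (auto simp: L2_def norm_mult power_mult_distrib)
qed

lemma integrable_mult_cnj:
  assumes f: "f \<in> L2" and g: "g \<in> L2"
  shows "integrable (lebesgue_on torus) (\<lambda>x. f x * cnj (g x))"
proof (rule Bochner_Integration.integrable_bound)
  show "integrable (lebesgue_on torus) (\<lambda>x. (cmod (f x))\<^sup>2 + (cmod (g x))\<^sup>2)"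
    using f g by (simp add: L2_def)
  show "(\<lambda>x. f x * cnj (g x)) \<in> borel_measurable (lebesgue_on torus)"
    using f g
    by (intro borel_measurable_times borel_measurable_continuous_on[where f = cnj])
      (auto simp: L2_def intro: continuous_intros)
  show "AE x in lebesgue_on torus. cmod (f x * cnj (g x)) \<le> norm ((cmod (f x))\<^sup>2 + (cmod (g x))\<^sup>2)"
  proof (rule AE_I2)
    fix x
    have "2 * (cmod (f x) * cmod (g x)) \<le> (cmod (f x))\<^sup>2 + (cmod (g x))\<^sup>2"
      using sum_squares_bound[of "cmod (f x)" "cmod (g x)"] by simp
    moreover have "0 \<le> cmod (f x) * cmod (g x)" by simp
    ultimately have "cmod (f x) * cmod (g x) \<le> (cmod (f x))\<^sup>2 + (cmod (g x))\<^sup>2" by linarith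
    then show "cmod (f x * cnj (g x)) \<le> norm ((cmod (f x))\<^sup>2 + (cmod (g x))\<^sup>2)"
      by (simp add: norm_mult)
  qed
qed

lemma L2_inner_cnj: "L2_inner g f = cnj (L2_inner f g)"
proof -
  have "(\<integral>x. g x * cnj (f x) \<partial>lebesgue_on torus) = (\<integral>x. cnj (f x * cnj (g x)) \<partial>lebesgue_on torus)"
    by (simp add: mult.commute)
  also have "\<dots> = cnj (\<integral>x. f x * cnj (g x) \<partial>lebesgue_on torus)"
    by (rule Bochner_Integration.integral_cnj)
  finally show ?thesis
    by (simp add: L2_inner_def)
qed

lemma L2_inner_diff_left:
  assumes "f \<in> L2" "g \<in> L2" "h \<in> L2"
  shows "L2_inner (f - g) h = L2_inner f h - L2_inner g h"
  using integrable_mult_cnj[OF assms(1,3)] integrable_mult_cnj[OF assms(2,3)]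
  by (simp add: L2_inner_def left_diff_distrib diff_divide_distrib)

lemma L2_inner_diff_right:
  assumes "f \<in> L2" "g \<in> L2" "h \<in> L2"
  shows "L2_inner h (f - g) = L2_inner h f - L2_inner h g"
  using L2_inner_diff_left[OF assms] by (metis L2_inner_cnj complex_cnj_diff)

lemma L2_inner_sum_left:
  fixes f :: "'i \<Rightarrow> real ^ 'n \<Rightarrow> complex"
  assumes "\<And>i. i \<in> I \<Longrightarrow> f i \<in> L2" "g \<in> L2"
  shows "L2_inner (\<lambda>x. \<Sum>i\<in>I. c i * f i x) g = (\<Sum>i\<in>I. c i * L2_inner (f i) g)"
proof -
  have "integrable (lebesgue_on torus) (\<lambda>x. c i * (f i x * cnj (g x)))" if "i \<in> I" for i
    using integrable_mult_cnj[OF assms(1)[OF that] assms(2)] by simp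
  then have "(\<integral>x. (\<Sum>i\<in>I. c i * (f i x * cnj (g x))) \<partial>lebesgue_on torus)
     = (\<Sum>i\<in>I. (\<integral>x. c i * (f i x * cnj (g x)) \<partial>lebesgue_on torus))"
    by (rule Bochner_Integration.integral_sum)
  then show ?thesis
    by (simp add: L2_inner_def sum_distrib_right mult.assoc sum_divide_distrib)
qed

lemma L2_inner_sum_right:
  fixes f :: "'i \<Rightarrow> real ^ 'n \<Rightarrow> complex"
  assumes "\<And>i. i \<in> I \<Longrightarrow> f i \<in> L2" "g \<in> L2"
  shows "L2_inner g (\<lambda>x. \<Sum>i\<in>I. c i * f i x) = (\<Sum>i\<in>I. cnj (c i) * L2_inner g (f i))"
  using L2_inner_sum_left[OF assms, where I = I and c = c]
  by (subst L2_inner_cnj) (auto simp: L2_inner_cnj[of g] intro!: sum.cong)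

lemma L2_norm_squared:
  fixes f :: "real ^ 'n \<Rightarrow> complex"
  shows "(L2_norm f)\<^sup>2 = (\<integral>x. (cmod (f x))\<^sup>2 \<partial>lebesgue_on torus) / (2 * pi) ^ CARD('n)"
    and L2_inner_self: "L2_inner f f = of_real ((L2_norm f)\<^sup>2)"
proof -
  have "(\<integral>x. f x * cnj (f x) \<partial>lebesgue_on torus) = (\<integral>x. complex_of_real ((cmod (f x))\<^sup>2) \<partial>lebesgue_on torus)"
    by (simp only: complex_norm_square)
  also have "\<dots> = of_real (\<integral>x. (cmod (f x))\<^sup>2 \<partial>lebesgue_on torus)"
    by (rule integral_complex_of_real)
  finally have *: "L2_inner f f
      = of_real ((\<integral>x. (cmod (f x))\<^sup>2 \<partial>lebesgue_on torus) / (2 * pi) ^ CARD('n))"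
    by (simp add: L2_inner_def)
  moreover have "0 \<le> (\<integral>x. (cmod (f x))\<^sup>2 \<partial>lebesgue_on torus) / (2 * pi) ^ CARD('n)"
    by simp
  ultimately show sq: "(L2_norm f)\<^sup>2 = (\<integral>x. (cmod (f x))\<^sup>2 \<partial>lebesgue_on torus) / (2 * pi) ^ CARD('n)"
    by (simp add: L2_norm_def)
  show "L2_inner f f = of_real ((L2_norm f)\<^sup>2)"
    by (simp add: * sq)
qed

lemma L2_norm_nonneg: "0 \<le> L2_norm f"
proof -
  have "0 \<le> Re (L2_inner f f)"
    by (subst L2_inner_self) simp
  then show ?thesis by (simp add: L2_norm_def)
qed

section \<open>Orthonormality of the exponentials\<close>

lemma continuous_on_trig: "continuous_on A (trig k)"
  unfolding trig_def by (intro continuous_intros)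

lemma trig_in_L2: "trig k \<in> L2"
  by (intro continuous_in_L2 continuous_on_trig)

lemma trig_add: "trig (k + l) x = trig k x * trig l x"
  by (simp add: trig_def ring_distribs sum.distrib exp_add)

lemma cnj_trig: "cnj (trig k x) = trig (- k) x"
  by (simp add: trig_def exp_cnj sum_negf)

text \<open>Fubini for separated variables: \<open>lborel\<close> is the image of the product of
  one-dimensional Lebesgue measures under the coordinate map.\<close>

lemma lborel_integral_prod_Basis:
  fixes G :: "'a::euclidean_space \<Rightarrow> real \<Rightarrow> complex"
  assumes "\<And>b. b \<in> Basis \<Longrightarrow> integrable lborel (G b)"
  shows "(\<integral>x. (\<Prod>b\<in>Basis. G b (x \<bullet> b)) \<partial>lborel) = (\<Prod>b\<in>Basis. integral\<^sup>L lborel (G b))"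
proof -
  interpret product_sigma_finite "\<lambda>_::'a. lborel :: real measure" ..
  have [measurable]: "G b \<in> borel_measurable borel" if "b \<in> Basis" for b
    using borel_measurable_integrable[OF assms[OF that]] by simp
  have "(\<integral>x. (\<Prod>b\<in>Basis. G b (x \<bullet> b)) \<partial>lborel)
      = (\<integral>f. (\<Prod>b\<in>Basis. G b ((\<Sum>c\<in>Basis. f c *\<^sub>R c) \<bullet> b)) \<partial>(\<Pi>\<^sub>M b\<in>Basis. lborel))"
    by (subst lborel_eq) (rule integral_distr; measurable)
  also have "\<dots> = (\<integral>f. (\<Prod>b\<in>Basis. G b (f b)) \<partial>(\<Pi>\<^sub>M b\<in>Basis. lborel))"
    by (intro Bochner_Integration.integral_cong refl prod.cong) simp
  also have "\<dots> = (\<Prod>b\<in>Basis. integral\<^sup>L lborel (G b))"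
    using assms by (intro product_integral_prod) auto
  finally show ?thesis .
qed

lemma integral_exp_2pi:
  fixes m :: int
  shows "integrable lborel (\<lambda>t. indicat_real {- pi..pi} t *\<^sub>R exp (\<i> * of_real (of_int m * t)))" (is ?int)
    and "(\<integral>t. indicat_real {- pi..pi} t *\<^sub>R exp (\<i> * of_real (of_int m * t)) \<partial>lborel)
      = (if m = 0 then of_real (2 * pi) else 0)" (is ?val)
proof -
  show ?int
    by (intro borel_integrable_compact) (auto intro!: continuous_intros)
  show ?val
  proof (cases "m = 0")
    case False
    have "(\<integral>t. indicat_real {- pi..pi} t *\<^sub>R exp (\<i> * of_real (of_int m * t)) \<partial>lborel)
      = exp (\<i> * of_real (of_int m * pi)) / (\<i> * of_int m) - exp (\<i> * of_real (of_int m * (- pi))) / (\<i> * of_int m)"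
    proof (rule integral_FTC_Icc)
      show "((\<lambda>t. exp (\<i> * of_real (of_int m * t)) / (\<i> * of_int m)) has_vector_derivative
          exp (\<i> * of_real (of_int m * t))) (at t within {- pi..pi})" for t
      proof -
        have "((\<lambda>z. exp (\<i> * of_int m * z) / (\<i> * of_int m)) has_field_derivative
            exp (\<i> * of_int m * of_real t)) (at (of_real t))"
          using False by (auto intro!: derivative_eq_intros)
        from has_vector_derivative_real_field[OF this] show ?thesis
          by (simp add: o_def mult.assoc)
      qed
    qed (auto intro!: continuous_intros)
    \<comment> \<open>The two arguments differ by \<open>m\<close> full periods 2 pi i.\<close>
    also have "exp (\<i> * of_real (of_int m * pi)) = exp (\<i> * of_real (of_int m * (- pi)))"
      by (rule exp_eq[THEN iffD2]) (rule exI[of _ m], simp)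
    finally show ?thesis
      using False by simp
  qed (simp add: scaleR_conv_of_real)
qed

lemma integral_trig:
  fixes k :: "int ^ 'n"
  shows "(\<integral>x. trig k x \<partial>lebesgue_on torus) = (if k = 0 then of_real ((2 * pi) ^ CARD('n)) else 0)"
proof -
  \<comment> \<open>The factors are indexed by basis vectors to match
    \<open>lborel_integral_prod_Basis\<close>. Each one carries its own indicator, which turns the
    integral over the cube into one over the whole space.\<close>
  define G where "G b t = indicat_real {- pi..pi} t *\<^sub>R
    exp (\<i> * of_real (of_int (k $ (axis_index b)) * t))" for b :: "real ^ 'n" and t
  have bij: "bij_betw (\<lambda>j. axis j 1) UNIV (Basis :: (real ^ 'n) set)"
    by (auto simp: bij_betw_def inj_on_def axis_eq_axis Basis_vec_def)
  have prod: "(\<Prod>b\<in>Basis. g b) = (\<Prod>j\<in>UNIV. g (axis j 1))" for g :: "real ^ 'n \<Rightarrow> complex"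
    using prod.reindex_bij_betw[OF bij, of g] by simp
  have ind: "indicat_real torus x = (\<Prod>j\<in>UNIV. indicat_real {- pi..pi} (x $ j))" for x :: "real ^ 'n"
    by (auto simp: indicator_def torus_iff abs_le_iff minus_le_iff)
  have fac: "indicat_real torus x *\<^sub>R trig k x = (\<Prod>b\<in>Basis. G b (x \<bullet> b))" for x
    unfolding prod G_def ind trig_def
    by (simp add: inner_axis axis_index_axis scaleR_conv_of_real prod.distrib of_real_prod
        exp_sum sum_distrib_left)
  have "(\<integral>x. trig k x \<partial>lebesgue_on torus) = (\<integral>x. indicat_real torus x *\<^sub>R trig k x \<partial>lebesgue)"
    by (rule integral_restrict_space) simp
  also have "\<dots> = (\<integral>x. indicat_real torus x *\<^sub>R trig k x \<partial>lborel)"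
    using borel_measurable_continuous_onI[OF continuous_on_trig[of UNIV k]]
    by (intro integral_completion) (auto simp: torus_def)
  also have "\<dots> = (\<Prod>b\<in>Basis. integral\<^sup>L lborel (G b))"
    unfolding fac unfolding G_def using integral_exp_2pi(1) by (intro lborel_integral_prod_Basis)
  also have "\<dots> = (\<Prod>j\<in>UNIV. if k $ j = 0 then of_real (2 * pi) else 0)"
    unfolding prod G_def axis_index_axis integral_exp_2pi(2) ..
  also have "\<dots> = (if k = 0 then of_real ((2 * pi) ^ CARD('n)) else 0)"
    by (auto simp: vec_eq_iff)
  finally show ?thesis .
qed

lemma L2_inner_trig:
  fixes k l :: "int ^ 'n"
  shows "L2_inner (trig k) (trig l) = (if k = l then 1 else 0)"
proof -
  have "trig k x * cnj (trig l x) = trig (k - l) x" for x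
    using trig_add[of k "- l" x] by (simp add: cnj_trig)
  then show ?thesis
    by (simp add: L2_inner_def integral_trig)
qed

section \<open>Trigonometric polynomials and Bessel's inequality\<close>

lemma sum_fun_apply: "(\<Sum>i\<in>I. f i) x = (\<Sum>i\<in>I. f i x)" for f :: "'i \<Rightarrow> 'a \<Rightarrow> complex"
  by (induction I rule: infinite_finite_induct) auto

abbreviation trig_poly :: "(real ^ 'n \<Rightarrow> complex) set" where
  "trig_poly \<equiv> cfun.span (range trig)"

lemma span_subset_L2: "B \<subseteq> L2 \<Longrightarrow> cfun.span B \<subseteq> L2"
  by (intro cfun.span_minimal subspace_L2)

lemma trig_poly_subset_L2: "trig_poly \<subseteq> L2"
  by (intro span_subset_L2) (auto simp: trig_in_L2)

lemma trig_poly_explicit: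
  assumes "p \<in> trig_poly"
  obtains F c where "finite F" "p = (\<lambda>x. \<Sum>k\<in>F. c k * trig k x)"
proof -
  obtain t r where t: "finite t" "t \<subseteq> range trig" "p = (\<Sum>a\<in>t. (\<lambda>x. r a * a x))"
    using assms unfolding cfun.span_explicit by auto
  \<comment> \<open>Selecting one frequency for each function in \<open>t\<close> makes the
    reindexing injective without a separate proof that \<open>trig\<close> is.\<close>
  obtain F where F: "inj_on trig F" "t = trig ` F"
    using t(2) unfolding subset_image_inj by auto
  have "finite F" using t(1) F by (simp add: finite_image_iff)
  moreover have "p = (\<lambda>x. \<Sum>k\<in>F. r (trig k) * trig k x)"
    unfolding t(3) F(2) by (simp add: fun_eq_iff sum_fun_apply sum.reindex F(1))
  ultimately show ?thesis by (rule that)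
qed

lemma trig_sum_in_span: "(\<lambda>x. \<Sum>k\<in>F. c k * trig k x) \<in> cfun.span (trig ` F)"
proof -
  have "(\<Sum>k\<in>F. (\<lambda>x. c k * trig k x)) \<in> cfun.span (trig ` F)"
    by (intro cfun.span_sum cfun.span_scale cfun.span_base) auto
  also have "(\<Sum>k\<in>F. (\<lambda>x. c k * trig k x)) = (\<lambda>x. \<Sum>k\<in>F. c k * trig k x)"
    by (simp add: fun_eq_iff sum_fun_apply)
  finally show ?thesis .
qed

lemma trig_sum_in_L2: "(\<lambda>x. \<Sum>k\<in>F. c k * trig k x) \<in> L2"
  using trig_sum_in_span span_subset_L2[of "trig ` F"] trig_in_L2 by blast

lemma fourier_coeff_trig_sum:
  assumes "finite F"
  shows "fourier_coeff (\<lambda>x. \<Sum>l\<in>F. c l * trig l x) k = (if k \<in> F then c k else 0)"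
  using assms unfolding fourier_coeff_def
  by (subst L2_inner_sum_left) (auto simp: trig_in_L2 L2_inner_trig if_distrib cong: if_cong)

text \<open>Completing the square for an orthonormal system. The choice of the Fourier coefficients
  for \<open>c\<close> yields Bessel's inequality, arbitrary \<open>c\<close> yields the optimality
  of partial sums, and taking the polynomial itself for \<open>f\<close> yields its norm.\<close>

lemma L2_norm_diff_trig_sum:
  assumes f: "f \<in> L2" and F: "finite F"
  shows "(L2_norm (f - (\<lambda>x. \<Sum>k\<in>F. c k * trig k x)))\<^sup>2
    = (L2_norm f)\<^sup>2 - (\<Sum>k\<in>F. (cmod (fourier_coeff f k))\<^sup>2) + (\<Sum>k\<in>F. (cmod (fourier_coeff f k - c k))\<^sup>2)"
proof -
  define p where "p = (\<lambda>x. \<Sum>k\<in>F. c k * trig k x)"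
  have p: "p \<in> L2" unfolding p_def by (rule trig_sum_in_L2)
  have fp: "L2_inner f p = (\<Sum>k\<in>F. cnj (c k) * fourier_coeff f k)"
    unfolding p_def fourier_coeff_def using f by (intro L2_inner_sum_right trig_in_L2)
  have pf: "L2_inner p f = (\<Sum>k\<in>F. c k * cnj (fourier_coeff f k))"
    by (subst L2_inner_cnj) (simp add: fp mult.commute)
  have "L2_inner p p = (\<Sum>k\<in>F. cnj (c k) * fourier_coeff p k)"
    unfolding fourier_coeff_def
    by (subst (2) p_def, intro L2_inner_sum_right trig_in_L2 p)
  then have pp: "L2_inner p p = (\<Sum>k\<in>F. cnj (c k) * c k)"
    by (simp add: p_def fourier_coeff_trig_sum F)
  have "complex_of_real ((L2_norm (f - p))\<^sup>2) = L2_inner (f - p) (f - p)"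
    by (simp add: L2_inner_self)
  also have "\<dots> = L2_inner f f - L2_inner p f - (L2_inner f p - L2_inner p p)"
    using f p by (simp add: L2_inner_diff_left L2_inner_diff_right cfun.subspace_diff[OF subspace_L2])
  also have "\<dots> = of_real ((L2_norm f)\<^sup>2) + (\<Sum>k\<in>F. (fourier_coeff f k - c k) * cnj (fourier_coeff f k - c k)
      - fourier_coeff f k * cnj (fourier_coeff f k))"
    by (simp add: fp pf pp L2_inner_self[of f] algebra_simps sum.distrib sum_subtractf)
  also have "\<dots> = of_real ((L2_norm f)\<^sup>2 - (\<Sum>k\<in>F. (cmod (fourier_coeff f k))\<^sup>2)
      + (\<Sum>k\<in>F. (cmod (fourier_coeff f k - c k))\<^sup>2))"
    by (simp only: complex_norm_square[symmetric] sum_subtractf of_real_add of_real_diff of_real_sum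
        add_diff_eq diff_add_eq)
  finally show ?thesis
    unfolding p_def of_real_eq_iff .
qed

lemma Bessel_inequality:
  assumes "f \<in> L2" "finite F"
  shows "(\<Sum>k\<in>F. (cmod (fourier_coeff f k))\<^sup>2) \<le> (L2_norm f)\<^sup>2"
  using L2_norm_diff_trig_sum[OF assms, of "fourier_coeff f"]
    zero_le_power2[of "L2_norm (f - (\<lambda>x. \<Sum>k\<in>F. fourier_coeff f k * trig k x))"]
  by simp

section \<open>Completeness of the trigonometric system\<close>

text \<open>Supplies the algebra property for Stone-Weierstrass. Span induction in each factor
  reduces it to the addition of frequencies.\<close>

lemma trig_poly_mult:
  assumes "p \<in> trig_poly" "q \<in> trig_poly"
  shows "(\<lambda>x. p x * q x) \<in> trig_poly"
  using assms(1)
proof (rule cfun.span_induct)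
  show "cfun.subspace {p. (\<lambda>x. p x * q x) \<in> trig_poly}"
  proof (rule cfun.subspaceI)
    show "0 \<in> {p. (\<lambda>x. p x * q x) \<in> trig_poly}"
      using cfun.span_zero by (simp add: zero_fun_def)
  next
    fix f g assume "f \<in> {p. (\<lambda>x. p x * q x) \<in> trig_poly}" "g \<in> {p. (\<lambda>x. p x * q x) \<in> trig_poly}"
    then show "f + g \<in> {p. (\<lambda>x. p x * q x) \<in> trig_poly}"
      using cfun.span_add[of "\<lambda>x. f x * q x" _ "\<lambda>x. g x * q x"] by (simp add: plus_fun_def distrib_right)
  next
    fix c f assume "f \<in> {p. (\<lambda>x. p x * q x) \<in> trig_poly}"
    then show "(\<lambda>x. c * f x) \<in> {p. (\<lambda>x. p x * q x) \<in> trig_poly}"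
      using cfun.span_scale[of "\<lambda>x. f x * q x" _ c] by (simp add: mult.assoc)
  qed
next
  fix r :: "real ^ 'a \<Rightarrow> complex" assume "r \<in> range trig"
  then obtain k where r: "r = trig k" by auto
  show "(\<lambda>x. r x * q x) \<in> trig_poly"
    using assms(2)
  proof (rule cfun.span_induct)
    show "cfun.subspace {q. (\<lambda>x. r x * q x) \<in> trig_poly}"
    proof (rule cfun.subspaceI)
      show "0 \<in> {q. (\<lambda>x. r x * q x) \<in> trig_poly}"
        using cfun.span_zero by (simp add: zero_fun_def)
    next
      fix f g assume "f \<in> {q. (\<lambda>x. r x * q x) \<in> trig_poly}" "g \<in> {q. (\<lambda>x. r x * q x) \<in> trig_poly}"
      then show "f + g \<in> {q. (\<lambda>x. r x * q x) \<in> trig_poly}"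
        using cfun.span_add[of "\<lambda>x. r x * f x" _ "\<lambda>x. r x * g x"] by (simp add: plus_fun_def distrib_left)
    next
      fix c f assume "f \<in> {q. (\<lambda>x. r x * q x) \<in> trig_poly}"
      then show "(\<lambda>x. c * f x) \<in> {q. (\<lambda>x. r x * q x) \<in> trig_poly}"
        using cfun.span_scale[of "\<lambda>x. r x * f x" _ c] by (simp add: mult.left_commute)
    qed
  next
    fix q :: "real ^ 'a \<Rightarrow> complex" assume "q \<in> range trig"
    then obtain l where "q = trig l" by auto
    then have "(\<lambda>x. r x * q x) = trig (k + l)"
      by (simp add: r trig_add fun_eq_iff)
    then show "(\<lambda>x. r x * q x) \<in> trig_poly"
      by (simp add: cfun.span_base)
  qed
qed

lemma trig_axis: "trig (axis j 1) x = cis (x $ j)" "trig (- axis j 1) x = cis (- (x $ j))"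
proof -
  have "(\<Sum>i\<in>UNIV. of_int (axis j 1 $ i) * x $ i) = x $ j"
    by (simp add: axis_def if_distrib[of "\<lambda>c. c * _"] if_distrib[of real_of_int] cong: if_cong)
  then show "trig (axis j 1) x = cis (x $ j)" "trig (- axis j 1) x = cis (- (x $ j))"
    by (simp_all add: trig_def cis_conv_exp sum_negf)
qed

text \<open>Euler's formulas. These are the real coordinates on the product of circles, and they
  separate its points.\<close>

lemma cos_sin_in_trig_poly:
  fixes j :: "'n::finite"
  shows "(\<lambda>x::real ^ 'n. complex_of_real (cos (x $ j))) \<in> trig_poly"
    and "(\<lambda>x::real ^ 'n. complex_of_real (sin (x $ j))) \<in> trig_poly"
proof -
  have k: "(\<lambda>x. c * trig k x) \<in> trig_poly" for k :: "int ^ 'n" and c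
    by (intro cfun.span_scale cfun.span_base) auto
  have "(\<lambda>x. 1 / 2 * trig (axis j 1) x) + (\<lambda>x. 1 / 2 * trig (- axis j 1) x) \<in> trig_poly"
    by (intro cfun.span_add k)
  also have "(\<lambda>x. 1 / 2 * trig (axis j 1) x) + (\<lambda>x. 1 / 2 * trig (- axis j 1) x)
      = (\<lambda>x. complex_of_real (cos (x $ j)))"
    by (simp add: fun_eq_iff trig_axis complex_eq_iff)
  finally show "(\<lambda>x::real ^ 'n. complex_of_real (cos (x $ j))) \<in> trig_poly" .
  have "(\<lambda>x. (- \<i> / 2) * trig (axis j 1) x) + (\<lambda>x. (\<i> / 2) * trig (- axis j 1) x) \<in> trig_poly"
    by (intro cfun.span_add k)
  also have "(\<lambda>x. (- \<i> / 2) * trig (axis j 1) x) + (\<lambda>x. (\<i> / 2) * trig (- axis j 1) x)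
      = (\<lambda>x. complex_of_real (sin (x $ j)))"
    by (simp add: fun_eq_iff trig_axis complex_eq_iff)
  finally show "(\<lambda>x::real ^ 'n. complex_of_real (sin (x $ j))) \<in> trig_poly" .
qed

lemma const_in_trig_poly: "(\<lambda>x. c) \<in> trig_poly"
proof -
  have "(\<lambda>x. c * trig 0 x) \<in> trig_poly"
    by (intro cfun.span_scale cfun.span_base) auto
  then show ?thesis by (simp add: trig_def)
qed

text \<open>
  Continuous functions that vanish on the boundary of the cube descend to the product of circles,
  where the Stone-Weierstrass theorem applies.
\<close>

lemma trig_poly_uniformly_dense_real:
  fixes h :: "real ^ 'n \<Rightarrow> real"
  assumes cont: "continuous_on torus h"
    and bd: "\<And>x j. x \<in> torus \<Longrightarrow> \<bar>x $ j\<bar> = pi \<Longrightarrow> h x = 0" and e: "e > 0"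
  shows "\<exists>p\<in>trig_poly. \<forall>x\<in>torus. cmod (of_real (h x) - p x) < e"
proof -
  \<comment> \<open>\<open>E\<close> wraps the cube onto a product of circles, and \<open>A\<close>
    chooses a preimage; \<open>h\<close> descends to the function \<open>h\<close> after
    \<open>A\<close> on the image.\<close>
  define E :: "real ^ 'n \<Rightarrow> complex ^ 'n" where "E x = (\<chi> j. cis (x $ j))" for x
  define A :: "complex ^ 'n \<Rightarrow> real ^ 'n" where "A z = (\<chi> j. Arg (z $ j))" for z
  define S where "S = E ` torus"
  \<comment> \<open>Real functions whose pullback along \<open>E\<close> is a trigonometric
    polynomial: Stone-Weierstrass is applied to a real algebra, whereas \<open>trig_poly\<close> is
    a complex space.\<close>
  define R where "R = {u. continuous_on S u \<and> (\<exists>p\<in>trig_poly. \<forall>x. complex_of_real (u (E x)) = p x)}"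
  have contE: "continuous_on X E" for X
    unfolding E_def by (intro continuous_intros)
  have S: "compact S"
    unfolding S_def by (intro compact_continuous_image contE compact_torus)
  interpret function_ring_on R S
  proof
    show "compact S" by (rule S)
  next
    fix f assume "f \<in> R" then show "continuous_on S f" by (simp add: R_def)
  next
    fix f g assume "f \<in> R" "g \<in> R"
    then obtain p q where pq: "p \<in> trig_poly" "q \<in> trig_poly"
        "\<And>x. of_real (f (E x)) = p x" "\<And>x. of_real (g (E x)) = q x"
      and "continuous_on S f" "continuous_on S g"
      by (auto simp: R_def)
    then have cont: "continuous_on S (\<lambda>x. f x + g x)" "continuous_on S (\<lambda>x. f x * g x)"
      by (auto intro: continuous_on_add continuous_on_mult)
    have "\<exists>p\<in>trig_poly. \<forall>x. complex_of_real (f (E x) + g (E x)) = p x"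
      by (rule bexI[OF _ cfun.span_add[OF pq(1,2)]]) (simp add: pq)
    moreover have "\<exists>p\<in>trig_poly. \<forall>x. complex_of_real (f (E x) * g (E x)) = p x"
      by (rule bexI[OF _ trig_poly_mult[OF pq(1,2)]]) (simp add: pq)
    ultimately show "(\<lambda>x. f x + g x) \<in> R" "(\<lambda>x. f x * g x) \<in> R"
      using cont by (simp_all only: R_def mem_Collect_eq simp_thms)
  next
    fix c show "(\<lambda>_. c) \<in> R"
      unfolding R_def using const_in_trig_poly[of "of_real c"] by auto
  next
    fix z w assume "z \<in> S" "w \<in> S" "z \<noteq> w"
    then obtain j where "z $ j \<noteq> w $ j" by (auto simp: vec_eq_iff)
    then have "Re (z $ j) \<noteq> Re (w $ j) \<or> Im (z $ j) \<noteq> Im (w $ j)"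
      by (simp add: complex_eq_iff)
    moreover have "(\<lambda>z. Re (z $ j)) \<in> R" "(\<lambda>z. Im (z $ j)) \<in> R"
      using cos_sin_in_trig_poly[of j]
      by (auto simp: R_def E_def intro!: continuous_intros)
    ultimately show "\<exists>f\<in>R. f z \<noteq> f w"
      by (elim disjE) (rule bexI[of "\<lambda>f. f z \<noteq> f w"], assumption+)+
  qed
  have AE: "h (A (E x)) = h x" "A (E x) \<in> torus" if x: "x \<in> torus" for x
  proof -
    \<comment> \<open>\<open>Arg\<close> takes values in (-pi, pi], so \<open>A\<close> moves the
      face -pi to the face pi. As \<open>h\<close> vanishes on both, its value does not
      change.\<close>
    have Arg: "Arg (cis (x $ j)) = (if x $ j = - pi then pi else x $ j)" for j
    proof (cases "x $ j = - pi")
      case False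
      then have "- pi < x $ j" "x $ j \<le> pi"
        using x by (auto simp: torus_iff abs_le_iff minus_le_iff less_le)
      then show ?thesis using False by (simp add: Arg_cis)
    next
      case True
      have "cis (- pi) = cis pi" by (simp add: complex_eq_iff)
      then show ?thesis using True Arg_cis[of pi] by simp
    qed
    show "A (E x) \<in> torus"
      using x by (auto simp: torus_iff A_def E_def Arg)
    show "h (A (E x)) = h x"
    proof (cases "\<exists>j. x $ j = - pi")
      case True
      then obtain j where j: "x $ j = - pi" by auto
      then have "h x = 0" using bd[OF x, of j] by simp
      moreover have "h (A (E x)) = 0"
        using j by (intro bd[of _ j] \<open>A (E x) \<in> torus\<close>) (simp add: A_def E_def Arg)
      ultimately show ?thesis by simp
    next
      case False
      then have "A (E x) = x" by (simp add: vec_eq_iff A_def E_def Arg)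
      then show ?thesis by simp
    qed
  qed
  \<comment> \<open>\<open>A\<close> itself jumps. Continuity holds because \<open>E\<close> is a
    quotient map from a compact set: the preimage of a closed set is the \<open>E\<close>-image of a
    compact subset of the cube.\<close>
  have "continuous_on S (\<lambda>z. h (A z))"
    unfolding continuous_on_closed_vimage[OF compact_imp_closed[OF S]]
  proof (intro allI impI)
    fix C :: "real set" assume "closed C"
    have "(\<lambda>z. h (A z)) -` C \<inter> S = E ` (torus \<inter> h -` C)"
      using AE by (auto simp: S_def)
    moreover have "compact (torus \<inter> h -` C)"
      using continuous_closed_preimage[OF cont compact_imp_closed[OF compact_torus] \<open>closed C\<close>] compact_torus
      by (metis Int_lower1 bounded_subset compact_eq_bounded_closed)
    ultimately show "closed ((\<lambda>z. h (A z)) -` C \<inter> S)"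
      using compact_continuous_image[OF contE] by (simp add: compact_imp_closed)
  qed
  from Stone_Weierstrass_basic[OF this e] obtain u where u: "u \<in> R" "\<And>z. z \<in> S \<Longrightarrow> \<bar>h (A z) - u z\<bar> < e"
    by blast
  then obtain p where p: "p \<in> trig_poly" "\<And>x. complex_of_real (u (E x)) = p x"
    by (auto simp: R_def)
  show ?thesis
  proof (intro bexI[OF _ p(1)] ballI)
    fix x :: "real ^ 'n" assume x: "x \<in> torus"
    then have "\<bar>h x - u (E x)\<bar> < e"
      using u(2)[of "E x"] AE(1)[OF x] by (simp add: S_def)
    then show "cmod (of_real (h x) - p x) < e"
      unfolding p(2)[symmetric] of_real_diff[symmetric] norm_of_real .
  qed
qed

lemma trig_poly_uniformly_dense:
  fixes h :: "real ^ 'n \<Rightarrow> complex"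
  assumes cont: "continuous_on torus h"
    and bd: "\<And>x j. x \<in> torus \<Longrightarrow> \<bar>x $ j\<bar> = pi \<Longrightarrow> h x = 0" and e: "e > 0"
  shows "\<exists>p\<in>trig_poly. \<forall>x\<in>torus. cmod (h x - p x) < e"
proof -
  have "e / 2 > 0" using e by simp
  have h: "continuous_on torus (\<lambda>x. Re (h x))" "continuous_on torus (\<lambda>x. Im (h x))"
    by (intro continuous_intros cont)+
  obtain p where p: "p \<in> trig_poly" "\<And>x. x \<in> torus \<Longrightarrow> cmod (of_real (Re (h x)) - p x) < e / 2"
    using trig_poly_uniformly_dense_real[OF h(1) _ \<open>e / 2 > 0\<close>] bd by auto
  obtain q where q: "q \<in> trig_poly" "\<And>x. x \<in> torus \<Longrightarrow> cmod (of_real (Im (h x)) - q x) < e / 2"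
    using trig_poly_uniformly_dense_real[OF h(2) _ \<open>e / 2 > 0\<close>] bd by auto
  show ?thesis
  proof (rule bexI[of _ "p + (\<lambda>x. \<i> * q x)"])
    show "p + (\<lambda>x. \<i> * q x) \<in> trig_poly"
      by (intro cfun.span_add cfun.span_scale p q)
    show "\<forall>x\<in>torus. cmod (h x - (p + (\<lambda>x. \<i> * q x)) x) < e"
    proof
      fix x :: "real ^ 'n" assume x: "x \<in> torus"
      have "h x - (p + (\<lambda>x. \<i> * q x)) x = (of_real (Re (h x)) - p x) + \<i> * (of_real (Im (h x)) - q x)"
        by (subst (1) complex_eq[of "h x"]) (simp add: algebra_simps)
      also have "cmod \<dots> \<le> cmod (of_real (Re (h x)) - p x) + cmod (\<i> * (of_real (Im (h x)) - q x))"
        by (rule norm_triangle_ineq)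
      also have "\<dots> < e / 2 + e / 2"
        using p(2)[OF x] q(2)[OF x] by (intro add_strict_mono) (simp_all add: norm_mult)
      finally show "cmod (h x - (p + (\<lambda>x. \<i> * q x)) x) < e" by simp
    qed
  qed
qed

section \<open>Density in mean square\<close>

lemma measure_torus: "measure (lebesgue_on torus) (torus :: (real ^ 'n) set) = (2 * pi) ^ CARD('n)"
proof -
  \<comment> \<open>The constant 1 is \<open>trig 0\<close>, so the volume can be read off from
    \<open>integral_trig\<close>.\<close>
  have "complex_of_real (measure (lebesgue_on torus) (torus :: (real ^ 'n) set))
      = (\<integral>x. trig (0 :: int ^ 'n) x \<partial>lebesgue_on torus)"
    by (simp add: trig_def scaleR_conv_of_real)
  also have "\<dots> = of_real ((2 * pi) ^ CARD('n))"
    by (simp only: integral_trig simp_thms if_True)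
  finally show ?thesis unfolding of_real_eq_iff .
qed

lemma L2_norm_squared_le:
  fixes f :: "real ^ 'n \<Rightarrow> complex"
  assumes "f \<in> L2" "\<And>x. x \<in> torus \<Longrightarrow> cmod (f x) \<le> \<delta>"
  shows "(L2_norm f)\<^sup>2 \<le> \<delta>\<^sup>2"
proof -
  interpret finite_measure "lebesgue_on torus :: (real ^ 'n) measure" by (rule finite_measure_torus)
  have "(\<integral>x. (cmod (f x))\<^sup>2 \<partial>lebesgue_on torus) \<le> (\<integral>x. \<delta>\<^sup>2 \<partial>lebesgue_on (torus :: (real ^ 'n) set))"
    using assms by (intro integral_mono) (auto simp: L2_def intro!: power_mono)
  also have "\<dots> = \<delta>\<^sup>2 * (2 * pi) ^ CARD('n)"
    by (simp add: measure_torus)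
  finally show ?thesis
    by (simp add: L2_norm_squared pos_divide_le_eq)
qed

text \<open>A substitute for Minkowski's inequality; the constant 2 is harmless where tolerances are
  arbitrary.\<close>

lemma L2_norm_squared_add_le:
  fixes f g :: "real ^ 'n \<Rightarrow> complex"
  assumes "f \<in> L2" "g \<in> L2"
  shows "(L2_norm (f + g))\<^sup>2 \<le> 2 * (L2_norm f)\<^sup>2 + 2 * (L2_norm g)\<^sup>2"
proof -
  have "f + g \<in> L2"
    using assms by (rule cfun.subspace_add[OF subspace_L2])
  moreover have "(cmod ((f + g) x))\<^sup>2 \<le> 2 * (cmod (f x))\<^sup>2 + 2 * (cmod (g x))\<^sup>2" for x
    by (simp add: norm_add_squared_le)
  ultimately have "(\<integral>x. (cmod ((f + g) x))\<^sup>2 \<partial>lebesgue_on torus)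
      \<le> (\<integral>x. 2 * (cmod (f x))\<^sup>2 + 2 * (cmod (g x))\<^sup>2 \<partial>lebesgue_on torus)"
    using assms by (intro integral_mono) (auto simp: L2_def)
  also have "\<dots> = 2 * (\<integral>x. (cmod (f x))\<^sup>2 \<partial>lebesgue_on torus) + 2 * (\<integral>x. (cmod (g x))\<^sup>2 \<partial>lebesgue_on torus)"
    using assms by (subst Bochner_Integration.integral_add) (auto simp: L2_def)
  finally show ?thesis
    unfolding L2_norm_squared times_divide_eq_right add_divide_distrib[symmetric]
    by (rule divide_right_mono) simp
qed

text \<open>Dominated convergence. The majorant \<open>w\<close> is a constant for bounded functions
  and the square of |f| for truncations.\<close>

lemma L2_norm_squared_approx:
  fixes f :: "real ^ 'n \<Rightarrow> complex"
  assumes f: "f \<in> L2" and g: "\<And>n. g n \<in> L2" and w: "integrable (lebesgue_on torus) w"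
    and lim: "AE x in lebesgue_on torus. (\<lambda>n. g n x) \<longlonglongrightarrow> f x"
    and bound: "\<And>n x. x \<in> torus \<Longrightarrow> (cmod (f x - g n x))\<^sup>2 \<le> w x" and e: "e > 0"
  shows "\<exists>n. (L2_norm (f - g n))\<^sup>2 < e"
proof -
  have diff: "f - g n \<in> L2" for n
    using f g by (rule cfun.subspace_diff[OF subspace_L2])
  have "(\<lambda>n. \<integral>x. (cmod (f x - g n x))\<^sup>2 \<partial>lebesgue_on torus) \<longlonglongrightarrow> (\<integral>x. 0 \<partial>lebesgue_on (torus :: (real ^ 'n) set))"
  proof (rule integral_dominated_convergence[where w = w])
    show "(\<lambda>x. (cmod (f x - g n x))\<^sup>2) \<in> borel_measurable (lebesgue_on torus)" for n
      using diff[of n] by (auto simp: L2_def)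
    show "AE x in lebesgue_on torus. (\<lambda>n. (cmod (f x - g n x))\<^sup>2) \<longlonglongrightarrow> 0"
      using lim
    proof eventually_elim
      case (elim x)
      have "(\<lambda>n. (cmod (f x - g n x))\<^sup>2) \<longlonglongrightarrow> (cmod (f x - f x))\<^sup>2"
        by (intro tendsto_intros elim)
      then show ?case by simp
    qed
    show "AE x in lebesgue_on torus. norm ((cmod (f x - g n x))\<^sup>2) \<le> w x" for n
      using bound by (intro AE_I2) simp
  qed (use w in simp_all)
  then have "(\<lambda>n. (L2_norm (f - g n))\<^sup>2) \<longlonglongrightarrow> 0"
    unfolding L2_norm_squared by (intro tendsto_divide_zero) simp
  then show ?thesis
    using e by (metis (mono_tags, lifting) eventually_happens' order_tendstoD(2) sequentially_bot)
qed

text \<open>Allows approximation through an intermediate class. The tolerance e / 4 is used for both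
  stages, since \<open>L2_norm_squared_add_le\<close> doubles each of them.\<close>

lemma trig_poly_approx_trans:
  assumes f: "f \<in> L2" and "\<And>e. e > 0 \<Longrightarrow> \<exists>g\<in>L2. (L2_norm (f - g))\<^sup>2 < e \<and> (\<exists>p\<in>trig_poly. (L2_norm (g - p))\<^sup>2 < e)"
    and e: "e > 0"
  shows "\<exists>p\<in>trig_poly. (L2_norm (f - p))\<^sup>2 < e"
proof -
  obtain g p where g: "g \<in> L2" "(L2_norm (f - g))\<^sup>2 < e / 4" and p: "p \<in> trig_poly" "(L2_norm (g - p))\<^sup>2 < e / 4"
    using assms(2)[of "e / 4"] e by auto
  have "(L2_norm (f - p))\<^sup>2 = (L2_norm ((f - g) + (g - p)))\<^sup>2"
    by simp
  also have "\<dots> \<le> 2 * (L2_norm (f - g))\<^sup>2 + 2 * (L2_norm (g - p))\<^sup>2"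
    using f g p trig_poly_subset_L2
    by (intro L2_norm_squared_add_le cfun.subspace_diff[OF subspace_L2]) auto
  also have "\<dots> < e" using g p by simp
  finally show ?thesis using p by blast
qed

text \<open>A measurable function is an almost everywhere limit of continuous \<open>g n\<close>.
  Two corrections keep them continuous: projection onto the ball of radius \<open>B\<close> makes
  them dominated, and the cutoff \<open>\<phi> n\<close> makes them vanish on the faces, as uniform
  approximation requires. The cutoff tends to 1 inside the open cube, and the faces are
  negligible.\<close>

lemma trig_poly_dense_bounded:
  fixes f :: "real ^ 'n \<Rightarrow> complex"
  assumes meas: "f \<in> borel_measurable (lebesgue_on torus)"
    and B: "\<And>x. cmod (f x) \<le> B" and e: "e > 0"
  shows "\<exists>p\<in>trig_poly. (L2_norm (f - p))\<^sup>2 < e"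
proof (rule trig_poly_approx_trans[OF _ _ e])
  show f: "f \<in> L2" using meas B by (rule bounded_measurable_in_L2)
  fix e :: real assume e: "e > 0"
  define Q :: "(real ^ 'n) set" where "Q = box (\<chi> j. - pi) (\<chi> j. pi)"
  have Q: "x \<in> Q \<longleftrightarrow> x \<in> torus \<and> (\<forall>j. \<bar>x $ j\<bar> \<noteq> pi)" for x
  proof -
    have "\<bar>t\<bar> < pi \<longleftrightarrow> - pi < t \<and> t < pi" for t by auto
    then have "x \<in> Q \<longleftrightarrow> (\<forall>j. \<bar>x $ j\<bar> < pi)"
      by (simp add: Q_def mem_box_cart)
    then show ?thesis
      by (simp add: torus_iff less_le all_conj_distrib)
  qed
  have "open Q" unfolding Q_def by (rule open_box)
  \<comment> \<open>\<open>infdist\<close> to the empty set is 0 by convention, so positivity of the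
    distance to \<open>- Q\<close> requires this set to be non-empty.\<close>
  have ne: "- Q \<noteq> {}"
  proof -
    have "(\<chi> j. pi) \<notin> Q" by (simp add: Q)
    then show ?thesis by blast
  qed
  have B0: "0 \<le> B" using order_trans[OF norm_ge_zero B] .
  have "f measurable_on torus"
    using meas by (simp add: measurable_on_iff_borel_measurable)
  then obtain N g where N: "negligible N" and g: "\<And>n. continuous_on UNIV (g n)"
    and lim: "\<And>x. x \<notin> N \<Longrightarrow> (\<lambda>n. g n x) \<longlonglongrightarrow> (if x \<in> torus then f x else 0)"
    unfolding measurable_on_def by auto
  define cl where "cl = closest_point (cball (0 :: complex) B)"
  define \<phi> where "\<phi> n x = min 1 (real n * infdist x (- Q))" for n :: nat and x
  define h where "h n x = complex_of_real (\<phi> n x) * cl (g n x)" for n x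
  have cl: "continuous_on X cl" for X
    unfolding cl_def using B0 by (intro continuous_on_closest_point) auto
  have cl_le: "cmod (cl z) \<le> B" for z
    using closest_point_in_set[of "cball 0 B" z] B0 by (simp add: cl_def)
  have cont: "continuous_on X (h n)" for n X
    unfolding h_def \<phi>_def
    by (intro continuous_intros continuous_on_compose2[OF cl[of UNIV] continuous_on_subset[OF g]]) auto
  have h_le: "cmod (h n x) \<le> B" for n x
    using mult_mono[of "\<bar>\<phi> n x\<bar>" 1 "cmod (cl (g n x))" B] cl_le[of "g n x"] B0
    by (simp add: h_def norm_mult \<phi>_def infdist_nonneg)
  have "negligible (torus - Q)"
    unfolding torus_def Q_def by (rule negligible_frontier_interval)
  then have "negligible (N \<union> (torus - Q))"
    using N by (rule negligible_Un[rotated])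
  then have "N \<union> (torus - Q) \<in> null_sets lebesgue"
    by (simp add: negligible_iff_null_sets)
  from AE_not_in[OF this] have "AE x in lebesgue. x \<in> torus \<longrightarrow> (\<lambda>n. h n x) \<longlonglongrightarrow> f x"
  proof eventually_elim
    case (elim x)
    show ?case
    proof
      assume x: "x \<in> torus"
      then have "(\<lambda>n. g n x) \<longlonglongrightarrow> f x" using lim[of x] elim by simp
      then have "(\<lambda>n. cl (g n x)) \<longlonglongrightarrow> cl (f x)"
        by (rule continuous_on_tendsto_compose[OF cl[of UNIV]]) auto
      moreover have "cl (f x) = f x"
        unfolding cl_def using B by (intro closest_point_self) simp
      moreover have "(\<lambda>n. complex_of_real (\<phi> n x)) \<longlonglongrightarrow> 1"
      proof (rule tendsto_eventually)
        have "x \<notin> - Q" using x elim by auto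
        then have "infdist x (- Q) > 0"
          using infdist_pos_not_in_closed[of "- Q" x] ne \<open>open Q\<close> by (auto simp: closed_Compl)
        then obtain n0 :: nat where "1 < real n0 * infdist x (- Q)"
          using reals_Archimedean3 by blast
        then have "\<phi> n x = 1" if "n \<ge> n0" for n
          using that mult_right_mono[of "real n0" "real n" "infdist x (- Q)"]
          by (simp add: \<phi>_def infdist_nonneg)
        then show "\<forall>\<^sub>F n in sequentially. complex_of_real (\<phi> n x) = 1"
          by (intro eventually_sequentiallyI[of n0]) simp
      qed
      ultimately show "(\<lambda>n. h n x) \<longlonglongrightarrow> f x"
        unfolding h_def using tendsto_mult[of "\<lambda>n. complex_of_real (\<phi> n x)" 1] by fastforce
    qed
  qed
  then have AE: "AE x in lebesgue_on torus. (\<lambda>n. h n x) \<longlonglongrightarrow> f x"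
    by (simp add: AE_restrict_space_iff)
  have hL2: "h n \<in> L2" for n
    by (intro continuous_in_L2 cont)
  have bound: "(cmod (f x - h n x))\<^sup>2 \<le> (2 * B)\<^sup>2" for n x
    using norm_triangle_ineq4[of "f x" "h n x"] B[of x] h_le[of n x] by (intro power_mono) auto
  interpret finite_measure "lebesgue_on torus :: (real ^ 'n) measure" by (rule finite_measure_torus)
  obtain n where n: "(L2_norm (f - h n))\<^sup>2 < e"
    using L2_norm_squared_approx[OF f hL2 _ AE bound e] by auto
  have "\<exists>p\<in>trig_poly. \<forall>x\<in>torus. cmod (h n x - p x) < sqrt (e / 2)"
  proof (rule trig_poly_uniformly_dense[OF cont])
    fix x :: "real ^ 'n" and j assume "\<bar>x $ j\<bar> = pi"
    then have "x \<in> - Q" by (auto simp: Q)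
    then show "h n x = 0" by (simp add: h_def \<phi>_def)
  qed (use e in simp)
  then obtain p where p: "p \<in> trig_poly" "\<And>x. x \<in> torus \<Longrightarrow> cmod ((h n - p) x) \<le> sqrt (e / 2)"
    by (auto intro: less_imp_le)
  have "h n - p \<in> L2"
    using hL2 p(1) trig_poly_subset_L2 by (intro cfun.subspace_diff[OF subspace_L2]) auto
  then have "(L2_norm (h n - p))\<^sup>2 \<le> (sqrt (e / 2))\<^sup>2"
    by (rule L2_norm_squared_le) (use p(2) in simp)
  then have "(L2_norm (h n - p))\<^sup>2 < e"
    using e by simp
  then show "\<exists>g\<in>L2. (L2_norm (f - g))\<^sup>2 < e \<and> (\<exists>p\<in>trig_poly. (L2_norm (g - p))\<^sup>2 < e)"
    using hL2 n p(1) by blast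
qed

text \<open>Setting \<open>f\<close> to 0 where it exceeds height \<open>n\<close> gives bounded
  functions; the error is 0 or \<open>f\<close> at each point, so the square of |f|
  dominates.\<close>

lemma trig_poly_dense:
  fixes f :: "real ^ 'n \<Rightarrow> complex"
  assumes f: "f \<in> L2" and e: "e > 0"
  shows "\<exists>p\<in>trig_poly. (L2_norm (f - p))\<^sup>2 < e"
proof (rule trig_poly_approx_trans[OF f _ e])
  fix e :: real assume e: "e > 0"
  define g where "g n x = (if cmod (f x) \<le> real n then f x else 0)" for n x
  have [measurable]: "f \<in> borel_measurable (lebesgue_on torus)"
    using f by (simp add: L2_def)
  have meas: "g n \<in> borel_measurable (lebesgue_on torus)" for n
    unfolding g_def by measurable
  have le: "cmod (g n x) \<le> real n" for n x
    by (simp add: g_def)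
  have gL2: "g n \<in> L2" for n
    using meas le by (rule bounded_measurable_in_L2)
  have lim: "AE x in lebesgue_on torus. (\<lambda>n. g n x) \<longlonglongrightarrow> f x"
  proof (rule AE_I2, rule tendsto_eventually)
    fix x
    obtain n0 :: nat where "cmod (f x) \<le> real n0" using real_arch_simple by blast
    then show "\<forall>\<^sub>F n in sequentially. g n x = f x"
      by (intro eventually_sequentiallyI[of n0]) (simp add: g_def)
  qed
  have bound: "(cmod (f x - g n x))\<^sup>2 \<le> (cmod (f x))\<^sup>2" for n x
    by (simp add: g_def)
  have int: "integrable (lebesgue_on torus) (\<lambda>x. (cmod (f x))\<^sup>2)"
    using f by (simp add: L2_def)
  obtain n where "(L2_norm (f - g n))\<^sup>2 < e"
    using L2_norm_squared_approx[OF f gL2 int lim bound e] by auto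
  moreover have "\<exists>p\<in>trig_poly. (L2_norm (g n - p))\<^sup>2 < e"
    using meas le e by (rule trig_poly_dense_bounded)
  ultimately show "\<exists>g\<in>L2. (L2_norm (f - g))\<^sup>2 < e \<and> (\<exists>p\<in>trig_poly. (L2_norm (g - p))\<^sup>2 < e)"
    using gL2 by blast
qed

text \<open>Stating completeness with a finite \<open>F\<close> and an error \<open>e\<close> avoids
  infinite sums over frequencies. Replacing the coefficients of an approximating polynomial by
  Fourier coefficients only reduces the error.\<close>

lemma Parseval_approx:
  assumes f: "f \<in> L2" and e: "e > 0"
  shows "\<exists>F. finite F \<and> (L2_norm f)\<^sup>2 < (\<Sum>k\<in>F. (cmod (fourier_coeff f k))\<^sup>2) + e"
proof -
  obtain p where p: "p \<in> trig_poly" "(L2_norm (f - p))\<^sup>2 < e"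
    using trig_poly_dense[OF assms] by blast
  obtain F c where F: "finite F" "p = (\<lambda>x. \<Sum>k\<in>F. c k * trig k x)"
    using trig_poly_explicit[OF p(1)] .
  have "0 \<le> (\<Sum>k\<in>F. (cmod (fourier_coeff f k - c k))\<^sup>2)"
    by (intro sum_nonneg) auto
  then show ?thesis
    using L2_norm_diff_trig_sum[OF f F(1), of c] p(2) F by (auto intro!: exI[of _ F])
qed

text \<open>The only form in which completeness is used from here on: Parseval for \<open>f\<close>
  and Bessel for \<open>g\<close>.\<close>

lemma L2_norm_le_if_fourier_coeff_le:
  assumes f: "f \<in> L2" and g: "g \<in> L2" and c: "c \<ge> 0"
    and le: "\<And>k. cmod (fourier_coeff f k) \<le> c * cmod (fourier_coeff g k)"
  shows "L2_norm f \<le> c * L2_norm g"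
proof -
  have "(L2_norm f)\<^sup>2 \<le> (c * L2_norm g)\<^sup>2 + e" if e: "e > 0" for e
  proof -
    obtain F where F: "finite F" "(L2_norm f)\<^sup>2 < (\<Sum>k\<in>F. (cmod (fourier_coeff f k))\<^sup>2) + e"
      using Parseval_approx[OF f e] by auto
    have "(\<Sum>k\<in>F. (cmod (fourier_coeff f k))\<^sup>2) \<le> (\<Sum>k\<in>F. c\<^sup>2 * (cmod (fourier_coeff g k))\<^sup>2)"
      unfolding power_mult_distrib[symmetric] by (intro sum_mono power_mono le) auto
    also have "\<dots> \<le> c\<^sup>2 * (L2_norm g)\<^sup>2"
      unfolding sum_distrib_left[symmetric]
      by (intro mult_left_mono Bessel_inequality g F) auto
    finally show ?thesis using F(2) by (simp add: power_mult_distrib)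
  qed
  then have "(L2_norm f)\<^sup>2 \<le> (c * L2_norm g)\<^sup>2"
    by (rule field_le_epsilon)
  then show ?thesis
    by (rule power2_le_imp_le) (simp add: c L2_norm_nonneg)
qed

section \<open>Widths and hyperbolic crosses\<close>

lemma korobov_weight_pos: "a > 0 \<Longrightarrow> korobov_weight a k > 0"
  unfolding korobov_weight_def by (intro prod_pos) (simp add: add_pos_nonneg)

text \<open>The weights are positive, so \<open>f\<close> determines the Fourier coefficients of
  \<open>g\<close>; comparing two candidates in both directions with constant 1 gives equal
  norms.\<close>

lemma korobov_norm_eq:
  fixes f g :: "real ^ 'n \<Rightarrow> complex"
  assumes a: "a > 0" and g: "g \<in> L2" and conv: "is_korobov_conv r a g f"
  shows "korobov_norm r a f = L2_norm g"
  unfolding korobov_norm_def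
proof (rule the_equality)
  show "\<exists>g'\<in>L2. is_korobov_conv r a g' f \<and> L2_norm g = L2_norm g'"
    using g conv by blast
next
  fix c assume "\<exists>g\<in>L2. is_korobov_conv r a g f \<and> c = L2_norm g"
  then obtain g' where g': "g' \<in> L2" "is_korobov_conv r a g' f" and c: "c = L2_norm g'"
    by blast
  have "fourier_coeff g' k = fourier_coeff g k" for k
  proof -
    have "of_real (korobov_weight a k powr (- r)) * fourier_coeff g' k
        = of_real (korobov_weight a k powr (- r)) * fourier_coeff g k"
      using conv g'(2) unfolding is_korobov_conv_def by metis
    then show ?thesis
      using korobov_weight_pos[OF a, of k] by simp
  qed
  then show "c = L2_norm g"
    using L2_norm_le_if_fourier_coeff_le[OF g g'(1), of 1] L2_norm_le_if_fourier_coeff_le[OF g'(1) g, of 1] c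
    by simp
qed

lemma mem_korobov_ball_iff:
  assumes "a > 0"
  shows "f \<in> korobov_ball r a \<longleftrightarrow> f \<in> L2 \<and> (\<exists>g\<in>L2. is_korobov_conv r a g f \<and> L2_norm g \<le> 1)"
  using korobov_norm_eq[OF assms, of _ r f] by (auto simp: korobov_ball_def korobov_space_def)

text \<open>Gaussian elimination, by induction on the set \<open>B\<close> of equations.\<close>

lemma homogeneous_system_solution:
  fixes A :: "'k \<Rightarrow> 'b \<Rightarrow> 'c::field"
  assumes "finite B" "finite F" "card B < card F"
  shows "\<exists>c. (\<exists>k\<in>F. c k \<noteq> 0) \<and> (\<forall>b\<in>B. (\<Sum>k\<in>F. c k * A k b) = 0)"
  using assms
proof (induction B arbitrary: F A rule: finite_induct)
  case empty
  then obtain k where "k \<in> F" by fastforce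
  then show ?case by (auto intro!: exI[of _ "\<lambda>_. 1"])
next
  case (insert b B)
  show ?case
  proof (cases "\<forall>k\<in>F. A k b = 0")
    case True
    obtain c where "\<exists>k\<in>F. c k \<noteq> 0" "\<forall>b\<in>B. (\<Sum>k\<in>F. c k * A k b) = 0"
      using insert.IH[of F A] insert.prems insert.hyps Suc_lessD by fastforce
    then show ?thesis using True by (auto intro!: exI[of _ c])
  next
    case False
    then obtain m where m: "m \<in> F" "A m b \<noteq> 0" by auto
    define F' where "F' = F - {m}"
    have F': "finite F'" "m \<notin> F'" "F = insert m F'" "card B < card F'"
      using insert m by (auto simp: F'_def)
    \<comment> \<open>Eliminates the unknown \<open>m\<close> by means of equation \<open>b\<close>,
      with pivot \<open>A m b\<close>.\<close>
    define A' where "A' k b' = A k b' - A k b / A m b * A m b'" for k b'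
    obtain c where c: "\<exists>k\<in>F'. c k \<noteq> 0" "\<forall>b'\<in>B. (\<Sum>k\<in>F'. c k * A' k b') = 0"
      using insert.IH[of F' A'] F' by auto
    \<comment> \<open>Back substitution: the value at \<open>m\<close> is forced by equation
      \<open>b\<close>, which then holds because \<open>A' k b = 0\<close>.\<close>
    define c' where "c' = c(m := - (\<Sum>k\<in>F'. c k * A k b) / A m b)"
    have sum: "(\<Sum>k\<in>F. c' k * A k b') = (\<Sum>k\<in>F'. c k * A' k b')" for b'
    proof -
      have "(\<Sum>k\<in>F'. c' k * A k b') = (\<Sum>k\<in>F'. c k * A k b')"
        using F' by (intro sum.cong) (auto simp: c'_def)
      then have "(\<Sum>k\<in>F. c' k * A k b') = - (\<Sum>k\<in>F'. c k * A k b) / A m b * A m b' + (\<Sum>k\<in>F'. c k * A k b')"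
        using F' by (simp add: c'_def)
      also have "\<dots> = (\<Sum>k\<in>F'. c k * A' k b')"
        by (simp add: A'_def right_diff_distrib sum_subtractf sum_divide_distrib sum_distrib_right mult.assoc)
      finally show ?thesis .
    qed
    have "A' k b = 0" for k using m by (simp add: A'_def)
    then have "\<forall>b'\<in>insert b B. (\<Sum>k\<in>F. c' k * A k b') = 0"
      using c(2) by (simp add: sum)
    moreover have "\<exists>k\<in>F. c' k \<noteq> 0"
      using c(1) F' by (auto simp: c'_def)
    ultimately show ?thesis by blast
  qed
qed

lemma L2_norm_trig_sum:
  fixes F :: "(int ^ 'n) set"
  assumes "finite F"
  shows "(L2_norm (\<lambda>x. \<Sum>k\<in>F. c k * trig k x))\<^sup>2 = (\<Sum>k\<in>F. (cmod (c k))\<^sup>2)"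
proof -
  have "L2_norm (0 :: real ^ 'n \<Rightarrow> complex) = 0"
    by (simp add: L2_norm_def L2_inner_def)
  then show ?thesis
    using L2_norm_diff_trig_sum[OF trig_sum_in_L2[of c F] assms, of c]
    by (simp add: fourier_coeff_trig_sum assms)
qed

lemma kolmogorov_width_korobov_le:
  fixes F :: "(int ^ 'n) set"
  assumes a: "a > 0" and r: "r > 0" and X: "X > 0"
    and F: "finite F" "card F \<le> N" "\<And>k. k \<notin> F \<Longrightarrow> X \<le> korobov_weight a k"
  shows "kolmogorov_width N (korobov_ball r a :: (real ^ 'n \<Rightarrow> complex) set) L2 L2_norm \<le> ereal (X powr (- r))"
  unfolding kolmogorov_width_def
proof (rule INF_lower2)
  show "cfun.span (trig ` F) \<in> {L. L \<subseteq> L2 \<and> (\<exists>B. finite B \<and> card B \<le> N \<and> L = cfun.span B)}"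
    using F(1) order_trans[OF card_image_le[OF F(1)] F(2)] span_subset_L2[of "trig ` F"] trig_in_L2
    by blast
  show "(SUP f\<in>korobov_ball r a. INF g\<in>cfun.span (trig ` F). ereal (L2_norm (f - g))) \<le> ereal (X powr (- r))"
  proof (rule SUP_least)
    fix f :: "real ^ 'n \<Rightarrow> complex" assume "f \<in> korobov_ball r a"
    then obtain g where f: "f \<in> L2" and g: "g \<in> L2" "L2_norm g \<le> 1" and conv: "is_korobov_conv r a g f"
      by (auto simp: mem_korobov_ball_iff[OF a])
    define p where "p = (\<lambda>x. \<Sum>k\<in>F. fourier_coeff f k * trig k x)"
    have p: "p \<in> L2" unfolding p_def by (rule trig_sum_in_L2)
    \<comment> \<open>On \<open>F\<close> the coefficients of \<open>f - p\<close> vanish, and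
      elsewhere they are those of \<open>g\<close> times at most
      \<open>X powr (- r)\<close>.\<close>
    have "L2_norm (f - p) \<le> X powr (- r) * L2_norm g"
    proof (rule L2_norm_le_if_fourier_coeff_le)
      show "f - p \<in> L2" using f p by (rule cfun.subspace_diff[OF subspace_L2])
      fix k
      have fp: "fourier_coeff (f - p) k = fourier_coeff f k - fourier_coeff p k"
        unfolding fourier_coeff_def by (rule L2_inner_diff_left[OF f p trig_in_L2])
      show "cmod (fourier_coeff (f - p) k) \<le> X powr (- r) * cmod (fourier_coeff g k)"
      proof (cases "k \<in> F")
        case True
        then have "fourier_coeff (f - p) k = 0"
          unfolding fp by (simp add: p_def fourier_coeff_trig_sum F(1))
        then show ?thesis by simp
      next
        case False
        then have "fourier_coeff (f - p) k = fourier_coeff f k"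
          unfolding fp by (simp add: p_def fourier_coeff_trig_sum F(1))
        then have "cmod (fourier_coeff (f - p) k) = korobov_weight a k powr (- r) * cmod (fourier_coeff g k)"
          using conv by (simp add: is_korobov_conv_def norm_mult)
        also have "\<dots> \<le> X powr (- r) * cmod (fourier_coeff g k)"
          using F(3)[OF False] X r by (intro mult_right_mono powr_mono2') auto
        finally show ?thesis .
      qed
    qed (use g in simp_all)
    also have "\<dots> \<le> X powr (- r)"
      using g(2) by (simp add: mult_left_le)
    finally show "(INF g\<in>cfun.span (trig ` F). ereal (L2_norm (f - g))) \<le> ereal (X powr (- r))"
      by (intro INF_lower2[of p]) (simp_all add: p_def trig_sum_in_span)
  qed
qed

lemma L2_norm_diff_orthogonal_ge:
  assumes f: "f \<in> L2" and g: "g \<in> L2" and orth: "L2_inner f g = 0"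
  shows "L2_norm f \<le> L2_norm (f - g)"
proof -
  have "L2_inner g f = 0"
    using orth by (subst L2_inner_cnj) simp
  then have "complex_of_real ((L2_norm (f - g))\<^sup>2) = of_real ((L2_norm f)\<^sup>2 + (L2_norm g)\<^sup>2)"
    unfolding L2_inner_self[symmetric] of_real_add
    using f g orth by (simp add: L2_inner_diff_left L2_inner_diff_right cfun.subspace_diff[OF subspace_L2])
  then have "(L2_norm f)\<^sup>2 \<le> (L2_norm (f - g))\<^sup>2"
    unfolding of_real_eq_iff by simp
  then show ?thesis
    by (rule power2_le_imp_le) (rule L2_norm_nonneg)
qed

text \<open>
  A nonzero trigonometric polynomial with frequencies in \<open>F\<close> can be chosen orthogonal to all of \<open>B\<close>,
  because this is a homogeneous system with fewer equations than unknowns.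
\<close>

lemma kolmogorov_width_korobov_ge:
  fixes F :: "(int ^ 'n) set"
  assumes a: "a > 0" and r: "r > 0" and X: "X > 0"
    and F: "finite F" "N < card F" "\<And>k. k \<in> F \<Longrightarrow> korobov_weight a k \<le> X"
  shows "ereal (X powr (- r)) \<le> kolmogorov_width N (korobov_ball r a :: (real ^ 'n \<Rightarrow> complex) set) L2 L2_norm"
  unfolding kolmogorov_width_def
proof (rule INF_greatest, clarify)
  fix B :: "(real ^ 'n \<Rightarrow> complex) set"
  assume span: "cfun.span B \<subseteq> L2" and B: "finite B" "card B \<le> N"
  have BL2: "b \<in> L2" if "b \<in> B" for b
    using span cfun.span_base[OF that] by blast
  obtain c where c: "\<exists>k\<in>F. c k \<noteq> 0" "\<And>b. b \<in> B \<Longrightarrow> (\<Sum>k\<in>F. c k * L2_inner (trig k) b) = 0"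
    using homogeneous_system_solution[OF B(1) F(1), of "\<lambda>k. L2_inner (trig k)"] B(2) F(2) by auto
  define S where "S = (\<Sum>k\<in>F. (cmod (c k))\<^sup>2)"
  have "S > 0"
    unfolding S_def using c(1) F(1) by (auto intro!: sum_pos2)
  \<comment> \<open>This scaling gives \<open>f\<close> the norm \<open>X powr (- r)\<close>; since
    the weights on \<open>F\<close> are at most \<open>X\<close>, its source \<open>g\<close> has
    norm at most 1.\<close>
  define \<gamma> where "\<gamma> = X powr (- r) / sqrt S"
  define f where "f = (\<lambda>x. \<Sum>k\<in>F. (\<gamma> * c k) * trig k x)"
  define g where "g = (\<lambda>x. \<Sum>k\<in>F. (korobov_weight a k powr r * \<gamma> * c k) * trig k x)"
  have f: "f \<in> L2" and g: "g \<in> L2"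
    unfolding f_def g_def by (rule trig_sum_in_L2)+
  have sum: "(\<Sum>k\<in>F. \<gamma>\<^sup>2 * (cmod (c k))\<^sup>2) = (X powr (- r))\<^sup>2"
    unfolding sum_distrib_left[symmetric] S_def[symmetric] \<gamma>_def
    using \<open>S > 0\<close> by (simp add: power_divide)
  have "(L2_norm f)\<^sup>2 = (X powr (- r))\<^sup>2"
    unfolding sum[symmetric] f_def
    by (simp add: L2_norm_trig_sum F(1) norm_mult power_mult_distrib)
  then have norm_f: "L2_norm f = X powr (- r)"
    by (simp add: L2_norm_nonneg)
  have "(L2_norm g)\<^sup>2 = (\<Sum>k\<in>F. (korobov_weight a k powr r)\<^sup>2 * (\<gamma>\<^sup>2 * (cmod (c k))\<^sup>2))"
    unfolding g_def L2_norm_trig_sum[OF F(1)] by (simp add: norm_mult power_mult_distrib mult.assoc)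
  also have "\<dots> \<le> (\<Sum>k\<in>F. (X powr r)\<^sup>2 * (\<gamma>\<^sup>2 * (cmod (c k))\<^sup>2))"
    using F(3) r korobov_weight_pos[OF a]
    by (intro sum_mono mult_right_mono power_mono powr_mono2) (auto intro: less_imp_le)
  also have "\<dots> = (X powr r)\<^sup>2 * (X powr (- r))\<^sup>2"
    by (simp only: sum[symmetric] sum_distrib_left)
  also have "\<dots> = 1"
    using X by (simp flip: power_mult_distrib powr_add)
  finally have norm_g: "L2_norm g \<le> 1"
    using power2_le_imp_le[of "L2_norm g" 1] by simp
  have "is_korobov_conv r a g f"
    unfolding is_korobov_conv_def
  proof
    fix k :: "int ^ 'n"
    have "korobov_weight a k powr (- r) * korobov_weight a k powr r = 1"
      using korobov_weight_pos[OF a, of k] by (simp flip: powr_add)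
    then have "complex_of_real (korobov_weight a k powr (- r)) * of_real (korobov_weight a k powr r) = 1"
      by (metis of_real_1 of_real_mult)
    then show "fourier_coeff f k = of_real (korobov_weight a k powr (- r)) * fourier_coeff g k"
      by (simp add: f_def g_def fourier_coeff_trig_sum F(1) mult.assoc[symmetric])
  qed
  then have "f \<in> korobov_ball r a"
    using f g norm_g by (auto simp: mem_korobov_ball_iff[OF a])
  moreover have "X powr (- r) \<le> L2_norm (f - h)" if h: "h \<in> cfun.span B" for h
  proof -
    have "L2_inner f b = 0" if "b \<in> B" for b
    proof -
      have "L2_inner f b = (\<Sum>k\<in>F. (\<gamma> * c k) * L2_inner (trig k) b)"
        unfolding f_def by (intro L2_inner_sum_left trig_in_L2 BL2 that)
      also have "\<dots> = \<gamma> * (\<Sum>k\<in>F. c k * L2_inner (trig k) b)"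
        by (simp add: sum_distrib_left mult.assoc)
      finally show ?thesis by (simp add: c(2)[OF that])
    qed
    moreover obtain u where "h = (\<Sum>b\<in>B. (\<lambda>x. u b * b x))"
      using h unfolding cfun.span_finite[OF B(1)] by auto
    then have "h = (\<lambda>x. \<Sum>b\<in>B. u b * b x)"
      by (simp add: fun_eq_iff sum_fun_apply)
    then have "L2_inner f h = (\<Sum>b\<in>B. cnj (u b) * L2_inner f b)"
      using f BL2 by (simp add: L2_inner_sum_right[where f = "\<lambda>b. b"])
    ultimately have "L2_inner f h = 0" by simp
    moreover have "h \<in> L2" using h span by blast
    ultimately show ?thesis
      using L2_norm_diff_orthogonal_ge[OF f] norm_f by simp
  qed
  ultimately show "ereal (X powr (- r)) \<le> (SUP f\<in>korobov_ball r a. INF g\<in>cfun.span B. ereal (L2_norm (f - g)))"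
    by (intro SUP_upper2[of f] INF_greatest) auto
qed

section \<open>Explicit estimates\<close>

text \<open>The cross in the vector encoding used for Fourier coefficients; \<open>cross\<close> is
  its counterpart for plain functions, where the index set may vary.\<close>

definition weight_sublevel :: "real \<Rightarrow> real \<Rightarrow> (int ^ 'n) set" where
  "weight_sublevel a X = {k. korobov_weight a k \<le> X}"

lemma bij_betw_weight_sublevel:
  "bij_betw vec_nth (weight_sublevel a X) (cross a UNIV X)"
  by (rule bij_betwI[where g = vec_lambda])
    (auto simp: weight_sublevel_def cross_def korobov_weight_def)

lemma finite_weight_sublevel: "a > 0 \<Longrightarrow> finite (weight_sublevel a X)"
  by (simp add: bij_betw_finite[OF bij_betw_weight_sublevel] finite_cross)

lemma card_weight_sublevel:
  "card (weight_sublevel a X :: (int ^ 'n) set) = card (cross a (UNIV :: 'n set) X)"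
  by (rule bij_betw_same_card[OF bij_betw_weight_sublevel])

text \<open>The logarithm is at least 1, so \<open>X\<close> is at most \<open>M\<close> and the
  logarithm at \<open>X\<close> is bounded by the one at \<open>M\<close>, which the denominator of
  \<open>X\<close> cancels. If \<open>X\<close> lies below the range of
  \<open>card_cross_le\<close>, the cross is empty.\<close>

lemma card_weight_sublevel_le:
  assumes "a > 1 / 2" "M > 0" "ln (M / (a - 1 / 2) ^ CARD('n)) \<ge> 1"
  defines "X \<equiv> M / (2 * ln (M / (a - 1 / 2) ^ CARD('n)) ^ (CARD('n) - 1))"
  shows "card (weight_sublevel a X :: (int ^ 'n) set) \<le> 2 ^ CARD('n) / fact (CARD('n) - 1) * M"
proof -
  define s where "s = CARD('n)"
  define b where "b = a - 1 / 2"
  define L where "L = ln (M / b ^ s)"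
  have b: "0 < b" using assms by (simp add: b_def)
  have L: "1 \<le> L" using assms by (simp add: L_def b_def s_def)
  have X: "X = M / (2 * L ^ (s - 1))" by (simp add: X_def L_def b_def s_def)
  have pow: "1 \<le> L ^ (s - 1)" using L by (rule one_le_power)
  have X0: "0 < X" using assms(2) L by (simp add: X)
  have "1 \<le> 2 * L ^ (s - 1)" using pow by linarith
  then have "M * 1 \<le> M * (2 * L ^ (s - 1))"
    using assms(2) by (intro mult_left_mono) auto
  then have XM: "X \<le> M"
    using L by (simp add: X pos_divide_le_eq)
  have C0: "0 \<le> 2 ^ s / fact (s - 1) * M" using assms(2) by simp
  show ?thesis
    unfolding card_weight_sublevel s_def[symmetric]
  proof (cases "b ^ s \<le> X")
    case True
    have "real (card (cross a (UNIV :: 'n set) X)) \<le> 2 ^ s / fact (s - 1) * X * ln (X / b ^ s) ^ (s - 1)"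
      using card_cross_le[of "UNIV :: 'n set" a X] assms(1) True by (simp add: s_def b_def)
    also have "\<dots> \<le> 2 ^ s / fact (s - 1) * X * L ^ (s - 1)"
    proof (intro mult_left_mono power_mono)
      show "ln (X / b ^ s) \<le> L"
        unfolding L_def using X0 XM b by (intro ln_mono divide_right_mono) auto
      show "0 \<le> ln (X / b ^ s)" using True b by simp
    qed (use X0 in simp)
    also have "\<dots> = 2 ^ s / fact (s - 1) * (X * L ^ (s - 1))"
      by simp
    also have "\<dots> \<le> 2 ^ s / fact (s - 1) * M"
      using assms(2) pow L by (intro mult_left_mono) (simp_all add: X)
    finally show "real (card (cross a (UNIV :: 'n set) X)) \<le> 2 ^ s / fact (s - 1) * M" .
  next
    case False
    then have "cross a (UNIV :: 'n set) X = {}"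
      using b by (intro cross_eq_empty[where b = b]) (auto simp: s_def b_def)
    then show "real (card (cross a (UNIV :: 'n set) X)) \<le> 2 ^ s / fact (s - 1) * M"
      using C0 by simp
  qed
qed

text \<open>\<open>M\<close> is chosen so that the count bound
  \<open>2 ^ s / fact (s - 1) * M\<close> equals \<open>N\<close>. Its denominator
  \<open>2 ^ s\<close> also turns the power of \<open>a - 1 / 2\<close> inside the logarithm into
  one of \<open>2 * a - 1\<close>.\<close>

lemma width_upper_bound:
  fixes a r :: real
  assumes a: "a > 1 / 2" and r: "r > 0" and N: "N \<ge> 1"
    and L: "ln (real N * fact (CARD('n) - 1) / (2 * a - 1) ^ CARD('n)) \<ge> 1"
  shows "kolmogorov_width N (korobov_ball r a :: (real ^ 'n \<Rightarrow> complex) set) L2 L2_norm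
    \<le> ereal (2 powr r * (inverse (real N * fact (CARD('n) - 1) / 2 ^ CARD('n))
        * ln (real N * fact (CARD('n) - 1) / (2 * a - 1) ^ CARD('n)) ^ (CARD('n) - 1)) powr r)"
proof -
  define s where "s = CARD('n)"
  define M where "M = real N * fact (s - 1) / 2 ^ s"
  define l where "l = ln (real N * fact (s - 1) / (2 * a - 1) ^ s)"
  define X where "X = M / (2 * l ^ (s - 1))"
  have "(2 * a - 1) ^ s = 2 ^ s * (a - 1 / 2) ^ s"
    by (simp flip: power_mult_distrib add: algebra_simps)
  then have l: "l = ln (M / (a - 1 / 2) ^ s)"
    by (simp add: l_def M_def)
  have M: "M > 0" using N by (simp add: M_def)
  have l1: "l \<ge> 1" using L by (simp add: l_def s_def)
  then have X0: "X > 0" using M by (simp add: X_def)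
  have "real (card (weight_sublevel a X :: (int ^ 'n) set)) \<le> 2 ^ s / fact (s - 1) * M"
    using card_weight_sublevel_le[where 'n = 'n, of a M] a M l1
    by (simp add: X_def l s_def)
  also have "\<dots> = real N" by (simp add: M_def)
  finally have card: "card (weight_sublevel a X :: (int ^ 'n) set) \<le> N" by simp
  have "kolmogorov_width N (korobov_ball r a :: (real ^ 'n \<Rightarrow> complex) set) L2 L2_norm \<le> ereal (X powr (- r))"
    using a r X0 card
    by (intro kolmogorov_width_korobov_le[of _ _ _ "weight_sublevel a X"] finite_weight_sublevel)
      (auto simp: weight_sublevel_def)
  also have "X powr (- r) = inverse X powr r"
    using X0 by (simp add: powr_minus inverse_powr)
  also have "inverse X = 2 * (inverse M * l ^ (s - 1))"
    by (simp add: X_def field_simps)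
  also have "(2 * (inverse M * l ^ (s - 1))) powr r = 2 powr r * (inverse M * l ^ (s - 1)) powr r"
    by (rule powr_mult)
  finally show ?thesis
    by (simp add: M_def l_def s_def)
qed

text \<open>With L = ln (T / b ^ s) the threshold reads T * L ^ s / (L + s - 1). As 16 is at least e
  ^ 2, L is at least 2; Bernoulli then gives L ^ (s - 1) >= s, hence L ^ s >= L + s - 1. So M >= T
  >= 16 * b ^ s, and ln 16 exceeds 1.\<close>

lemma ln_ge_1_if_ge_threshold:
  fixes b T M :: real
  assumes s: "s \<ge> 2" and b: "b > 0" and T: "T \<ge> 16 * b ^ s"
    and M: "M \<ge> T * (ln T - real s * ln b) ^ s / (ln T + real s * (1 - ln b) - 1)"
  shows "ln (M / b ^ s) \<ge> 1"
proof -
  define L where "L = ln T - real s * ln b"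
  have T0: "T > 0" using T b by (meson less_le_trans mult_pos_pos zero_less_numeral zero_less_power)
  have "exp 2 = exp 1 * (exp 1 :: real)"
    by (simp flip: exp_add)
  also have "\<dots> \<le> 3 * 3"
    using exp_le by (intro mult_mono) auto
  finally have e2: "exp 2 \<le> (16 :: real)" by simp
  have L2: "L \<ge> 2"
  proof -
    have "L = ln (T / b ^ s)"
      using T0 b by (simp add: L_def ln_div ln_realpow)
    moreover have "16 \<le> T / b ^ s" using T b by (simp add: field_simps)
    ultimately show ?thesis using e2 by (simp add: ln_ge_iff)
  qed
  obtain q where q: "s = Suc q" using s by (cases s) auto
  have "L + real s - 1 \<le> L ^ s"
  proof -
    have "1 + real q * (L - 1) \<le> (1 + (L - 1)) ^ q"
      using L2 by (intro Bernoulli_inequality) auto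
    then have "1 + real q * (L - 1) \<le> L ^ q" by simp
    moreover have "real q \<le> real q * (L - 1)"
      using L2 by (simp add: mult_le_cancel_left1)
    ultimately have "1 + real q \<le> L ^ q" by simp
    then have "L * (1 + real q) \<le> L ^ s"
      unfolding q power_Suc using L2 by (intro mult_left_mono) auto
    moreover have "1 * real q \<le> L * real q"
      using L2 by (intro mult_right_mono) auto
    ultimately show ?thesis by (simp add: q ring_distribs)
  qed
  then have "1 \<le> L ^ s / (L + real s - 1)"
    using L2 s by (simp add: pos_le_divide_eq)
  then have "T * 1 \<le> T * (L ^ s / (L + real s - 1))"
    using T0 by (intro mult_left_mono) auto
  also have "\<dots> \<le> M"
    using M by (simp add: L_def algebra_simps)
  finally have "16 * b ^ s \<le> M" using T by simp
  then have "16 \<le> M / b ^ s" using b by (simp add: field_simps)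
  moreover have "exp 1 \<le> (16 :: real)" using exp_le by simp
  ultimately show ?thesis by (subst ln_ge_iff) auto
qed

text \<open>Let t be the logarithm in the statement and Y the level. Then ln (Y / D) = t + K - q *
  ln t is asymptotic to t, and \<open>card_cross_ge\<close> gives the count N * (s + 2) / 2 * (ln (Y
  / D) / t) ^ q. Once the last power exceeds 1/2, this is larger than N * (s + 2) / 4, which is at
  least N for s >= 2.\<close>

lemma card_weight_sublevel_ge_eventually:
  fixes a :: real
  assumes s: "s = CARD('n)" "s \<ge> 2" and a: "a > 0"
  shows "\<forall>\<^sub>F N in sequentially.
    0 < ln (real N * fact (s - 1) / (2 * a + 1) ^ s) \<and>
    N < card (weight_sublevel a (real N * fact (s - 1) * (real s + 2) / 2 ^ s
        / ln (real N * fact (s - 1) / (2 * a + 1) ^ s) ^ (s - 1)) :: (int ^ 'n) set)"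
proof -
  define q where "q = s - 1"
  define D where "D = (2 * a + 1) * (a + 1) ^ q"
  \<comment> \<open>Since N * q! = 2 ^ s * (a + 1/2) ^ s * exp t, the level becomes \<kappa> * exp t
    / t ^ q.\<close>
  define \<kappa> where "\<kappa> = (real s + 2) * (a + 1 / 2) ^ s"
  define K where "K = ln (\<kappa> / D)"
  define t where "t N = ln (real N * fact q / (2 * a + 1) ^ s)" for N
  have D: "D > 0" using a by (simp add: D_def)
  have \<kappa>: "\<kappa> > 0" using a by (simp add: \<kappa>_def)
  have ratio: "((\<lambda>t. (t + K - real q * ln t) / t) \<longlongrightarrow> 1) at_top"
    by real_asymp
  then have "((\<lambda>t. ((t + K - real q * ln t) / t) ^ q) \<longlongrightarrow> 1 ^ q) at_top"
    by (rule tendsto_power)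
  then have "\<forall>\<^sub>F t in at_top. 1 / 2 < ((t + K - real q * ln t) / t) ^ q"
    by (rule order_tendstoD) simp
  moreover have "\<forall>\<^sub>F t in at_top. 0 < (t + K - real q * ln t) / t"
    using ratio by (rule order_tendstoD) simp
  ultimately have ev: "\<forall>\<^sub>F t in at_top. 0 < t \<and> 0 < (t + K - real q * ln t) / t
      \<and> 1 / 2 < ((t + K - real q * ln t) / t) ^ q"
    using eventually_gt_at_top[of 0] by eventually_elim simp
  have C: "fact q / (2 * a + 1) ^ s > 0" using a by simp
  have "filterlim t at_top sequentially"
  proof -
    have "filterlim (\<lambda>N. ln (fact q / (2 * a + 1) ^ s * real N)) at_top sequentially"
      using C by real_asymp
    moreover have "t = (\<lambda>N. ln (fact q / (2 * a + 1) ^ s * real N))"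
      by (simp add: t_def fun_eq_iff mult.commute)
    ultimately show ?thesis by simp
  qed
  from eventually_compose_filterlim[OF ev this] show ?thesis
    using eventually_gt_at_top[of 0]
  proof eventually_elim
    case (elim N)
    define \<tau> where "\<tau> = t N"
    define Y where "Y = real N * fact q * (real s + 2) / 2 ^ s / \<tau> ^ q"
    have \<tau>: "0 < \<tau>" "0 < (\<tau> + K - real q * ln \<tau>) / \<tau>"
        "1 / 2 < ((\<tau> + K - real q * ln \<tau>) / \<tau>) ^ q"
      using elim by (simp_all add: \<tau>_def)
    have "exp \<tau> = real N * fact q / (2 * a + 1) ^ s"
      using elim a by (simp add: \<tau>_def t_def)
    moreover have "(2 * a + 1) ^ s = 2 ^ s * (a + 1 / 2) ^ s"
      by (simp flip: power_mult_distrib add: algebra_simps)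
    ultimately have Y: "Y = \<kappa> * exp \<tau> / \<tau> ^ q"
      using a by (simp add: Y_def \<kappa>_def)
    have Y0: "Y > 0" using \<kappa> \<tau> by (simp add: Y)
    have lnY: "ln (Y / D) = \<tau> + K - real q * ln \<tau>"
      using \<kappa> D \<tau> by (simp add: Y K_def ln_div ln_mult ln_realpow)
    have pos: "0 < ln (Y / D)"
      using \<tau> unfolding lnY by (simp add: zero_less_divide_iff)
    then have "D \<le> Y" using D Y0 by (simp add: ln_gt_zero_iff)
    have "real N * 1 \<le> real N * ((real s + 2) / 4)"
      using s(2) by (intro mult_left_mono) auto
    then have "real N \<le> real N * ((real s + 2) / 2) * (1 / 2)"
      by simp
    also have "\<dots> < real N * ((real s + 2) / 2) * (ln (Y / D) / \<tau>) ^ q"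
      using \<tau>(3) elim unfolding lnY by (intro mult_strict_left_mono) auto
    also have "\<dots> = 2 ^ s / (2 * fact q) * Y * ln (Y / D) ^ q"
      using \<tau> by (simp add: Y_def power_divide)
    also have "\<dots> \<le> real (card (weight_sublevel a Y :: (int ^ 'n) set))"
      using card_cross_ge[of "UNIV :: 'n set" a Y] a \<open>D \<le> Y\<close>
      by (simp add: card_weight_sublevel D_def q_def s)
    finally show ?case
      using \<tau>(1) by (simp add: Y_def \<tau>_def t_def q_def)
  qed
qed

theorem theorem5p3:
  fixes s :: nat and a T :: real and d :: "real \<Rightarrow> nat \<Rightarrow> ereal"
  assumes "s = CARD('n::finite)" and "s \<ge> 2" and "a > 1 / 2"
    and d: "\<And>r N. d r N =
          kolmogorov_width N (korobov_ball r a :: (real ^ 'n \<Rightarrow> complex) set) L2 L2_norm"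
    and T: "T = 16 * of_int \<lceil>(a + 1 / 2) ^ s\<rceil>"
  shows "(\<forall>r>0. \<forall>N\<ge>1.
            real N \<ge> 2 ^ s / fact (s - 1) *
              (T * (ln T - real s * ln (a - 1 / 2)) ^ s
                / (ln T + real s * (1 - ln (a - 1 / 2)) - 1)) \<longrightarrow>
            d r N \<le> ereal (2 powr r *
              (inverse (real N * fact (s - 1) / 2 ^ s)
                * ln (real N * fact (s - 1) / (2 * a - 1) ^ s) ^ (s - 1)) powr r))
       \<and> (\<exists>Nstar\<ge>1. \<forall>r>0. \<forall>N\<ge>Nstar.
            d r N \<ge> ereal (1 / 2 *
              (inverse (real N * fact (s - 1) * (real s + 2) / 2 ^ s)
                * ln (real N * fact (s - 1) / (2 * a + 1) ^ s) ^ (s - 1)) powr r))"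
proof (intro conjI allI impI)
  fix r :: real and N :: nat
  assume r: "0 < r" and N: "1 \<le> N"
    and thr: "real N \<ge> 2 ^ s / fact (s - 1) *
              (T * (ln T - real s * ln (a - 1 / 2)) ^ s
                / (ln T + real s * (1 - ln (a - 1 / 2)) - 1))"
  have b: "a - 1 / 2 > 0" using assms(3) by simp
  \<comment> \<open>The ceiling in \<open>T\<close> dominates the power of \<open>a + 1 / 2\<close>,
    hence that of the smaller \<open>a - 1 / 2\<close> which the threshold lemma asks for.\<close>
  have "(a - 1 / 2) ^ s \<le> (a + 1 / 2) ^ s"
    using b by (intro power_mono) auto
  also have "\<dots> \<le> of_int \<lceil>(a + 1 / 2) ^ s\<rceil>" by (rule le_of_int_ceiling)
  finally have "T \<ge> 16 * (a - 1 / 2) ^ s" by (simp add: T)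
  moreover have "real N * fact (s - 1) / 2 ^ s \<ge> T * (ln T - real s * ln (a - 1 / 2)) ^ s
                / (ln T + real s * (1 - ln (a - 1 / 2)) - 1)"
  proof -
    have "Q \<le> real N * fact (s - 1) / 2 ^ s" if "2 ^ s / fact (s - 1) * Q \<le> real N" for Q
      using that by (simp add: field_simps)
    then show ?thesis using thr .
  qed
  ultimately have "ln (real N * fact (s - 1) / 2 ^ s / (a - 1 / 2) ^ s) \<ge> 1"
    by (rule ln_ge_1_if_ge_threshold[OF assms(2) b])
  moreover have "(2 * a - 1) ^ s = 2 ^ s * (a - 1 / 2) ^ s"
    by (simp flip: power_mult_distrib add: algebra_simps)
  ultimately have "ln (real N * fact (s - 1) / (2 * a - 1) ^ s) \<ge> 1"
    by simp
  then show "d r N \<le> ereal (2 powr r *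
              (inverse (real N * fact (s - 1) / 2 ^ s)
                * ln (real N * fact (s - 1) / (2 * a - 1) ^ s) ^ (s - 1)) powr r)"
    unfolding d assms(1) using assms(3) r N by (intro width_upper_bound)
next
  have a: "a > 0" using assms(3) by simp
  obtain n0 where n0: "\<And>N. N \<ge> n0 \<Longrightarrow> 0 < ln (real N * fact (s - 1) / (2 * a + 1) ^ s) \<and>
    N < card (weight_sublevel a (real N * fact (s - 1) * (real s + 2) / 2 ^ s
        / ln (real N * fact (s - 1) / (2 * a + 1) ^ s) ^ (s - 1)) :: (int ^ 'n) set)"
    using card_weight_sublevel_ge_eventually[OF assms(1,2) a] unfolding eventually_sequentially by blast
  show "\<exists>Nstar\<ge>1. \<forall>r>0. \<forall>N\<ge>Nstar.
            d r N \<ge> ereal (1 / 2 *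
              (inverse (real N * fact (s - 1) * (real s + 2) / 2 ^ s)
                * ln (real N * fact (s - 1) / (2 * a + 1) ^ s) ^ (s - 1)) powr r)"
  \<comment> \<open>\<open>n0\<close> comes from counting alone, so one threshold serves all
    \<open>r\<close>; the maximum with 1 makes \<open>N\<close>, and hence the level
    \<open>Y\<close>, positive.\<close>
  proof (rule exI[of _ "max 1 n0"], intro conjI allI impI)
    fix r :: real and N :: nat assume r: "0 < r" and N: "max 1 n0 \<le> N"
    define t where "t = ln (real N * fact (s - 1) / (2 * a + 1) ^ s)"
    define Y where "Y = real N * fact (s - 1) * (real s + 2) / 2 ^ s / t ^ (s - 1)"
    have t: "0 < t" and card: "N < card (weight_sublevel a Y :: (int ^ 'n) set)"
      using n0[of N] N by (simp_all add: t_def Y_def)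
    have Y: "Y > 0" using N t by (simp add: Y_def)
    have "inverse (real N * fact (s - 1) * (real s + 2) / 2 ^ s) * t ^ (s - 1) = inverse Y"
      by (simp add: Y_def)
    then have "1 / 2 * (inverse (real N * fact (s - 1) * (real s + 2) / 2 ^ s) * t ^ (s - 1)) powr r
        = 1 / 2 * Y powr (- r)"
      using Y by (simp add: powr_minus inverse_powr)
    also have "\<dots> \<le> Y powr (- r)" by simp
    also have "ereal (Y powr (- r)) \<le> d r N"
      unfolding d using a r Y card
      by (intro kolmogorov_width_korobov_ge[of _ _ _ "weight_sublevel a Y"] finite_weight_sublevel)
        (auto simp: weight_sublevel_def)
    finally show "d r N \<ge> ereal (1 / 2 *
              (inverse (real N * fact (s - 1) * (real s + 2) / 2 ^ s)
                * ln (real N * fact (s - 1) / (2 * a + 1) ^ s) ^ (s - 1)) powr r)"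
      by (simp add: t_def)
  qed simp
qed

end
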